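(* Let $l\ge 1$ and $k_1,\dots,k_l\ge 1$ be fixed integers and put $r=\sum_{i=1}^l k_i$. For each $h$ let $[B_i(h),C_i(h)]\subset[0,h]$, $1\le i\le l$, be subintervals of $[0,h]$, and put $d_i(h)=C_i(h)-B_i(h)$. Assume that for some $\delta$ with $0<\delta<1$ we have $h^{\delta}=o(d_i(h))$ as $h\to\infty$ for all $i\le l$. Then, as $h\to\infty$, $$\sum_{\substack{A_1,A_2,\dots,A_l:\\ A_i\subset[B_i(h),C_i(h)],\ |A_i|=k_i}}\mathfrak{S}\Big(\bigcup_{i=1}^l A_i\Big)=\prod_{i=1}^l\frac{d_i(h)^{k_i}}{k_i!}\left(1+O_{r,\delta}\Big(\frac{1}{\log\log h}\Big)\right),$$ where the sum is over all $l$-tuples $(A_1,\dots,A_l)$ of sets of integers with $A_i\subset[B_i(h),C_i(h)]$ and $|A_i|=k_i$ for each $i$.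
   Context: The singular series of a finite set $\mathcal{H}$ of integers is $$\mathfrak{S}(\mathcal{H})=\prod_{p}\Big(1-\frac{|\Omega_{\mathcal{H}}(p)|}{p}\Big)\Big(1-\frac1p\Big)^{-|\mathcal{H}|},$$ where $p$ runs over primes and $\Omega_{\mathcal{H}}(p)$ is the set of residue classes modulo $p$ occupied by the elements of $\mathcal{H}$. Subscripts on $O$ indicate the parameters on which the implied constant depends; the estimate is asserted for all sufficiently large $h$. *)

theory Defs
  imports "HOL-Analysis.Analysis" "HOL-Library.Landau_Symbols"
    "HOL-Computational_Algebra.Primes"
begin

text \<open>A residue class modulo \<open>p\<close> is represented by its least non-negative element.\<close>

definition occupied_classes :: "int set \<Rightarrow> nat \<Rightarrow> int set" where
  "occupied_classes H p = (\<lambda>a. a mod int p) ` H"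

text \<open>
  The Euler product is taken over all natural numbers, with factor 1 at the non-primes.
  For finite \<open>H\<close> the factor at a large prime \<open>p\<close> is \<open>1 + O(1/p^2)\<close>, so the product
  converges. A vanishing factor makes it 0: \<^const>\<open>has_prod\<close>, which underlies
  \<^const>\<open>prodinf\<close>, allows finitely many zero factors.
\<close>

definition singular_series :: "int set \<Rightarrow> real" where
  "singular_series H =
     (\<Prod>p. if prime p
           then (1 - real (card (occupied_classes H p)) / real p)
                  * (1 - 1 / real p) powi (- int (card H))
           else 1)"

definition subsets_of_size :: "real \<Rightarrow> real \<Rightarrow> nat \<Rightarrow> int set set" where
  "subsets_of_size b c k = {A. A \<subseteq> {n. real_of_int n \<in> {b..c}} \<and> card A = k}"

end

theory Submission
  imports Defs "HOL-Number_Theory.Cong" "HOL-Real_Asymp.Real_Asymp"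
begin

text \<open>
  Let \<open>y = \<lfloor>c log h\<rfloor>\<close> with \<open>c = \<delta>/4\<close>, let \<open>P\<close> be the product of the primes up to \<open>y\<close> and
  \<open>D\<close> the product of \<open>1 - 1/p\<close> over these primes. The Euler product is cut at \<open>y\<close>, and the two
  parts are treated by different means.

  Beyond \<open>y\<close> the product is close to 1 for every single set \<open>H \<subseteq> [0,h]\<close> with at most \<open>r\<close>
  elements (\<open>singular_series_bounds\<close>). A prime that divides no difference of elements of \<open>H\<close>
  contributes \<open>1 + O(1/p\<^sup>2)\<close>; any other one contributes at most \<open>exp(r/y)\<close>, and because the
  differences are at most \<open>h\<close>, at most \<open>r\<^sup>2 log h / log y\<close> primes above \<open>y\<close> are of this kind.
  The total error is \<open>O(log h / (y log y)) = O(1/log log h)\<close>, and this is the error term of the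
  theorem.

  Up to \<open>y\<close> only the average over \<open>H\<close> is under control, but that average is almost exact. By the
  Chinese remainder theorem the product of \<open>1 - |\<Omega>(p)|/p\<close> is the proportion of shifts \<open>t\<close>
  modulo \<open>P\<close> for which no element of \<open>H - t\<close> is divisible by a prime up to \<open>y\<close>
  (\<open>sieve_weight_eq_average\<close>). After the sums over \<open>t\<close> and over the tuples \<open>(A\<^sub>1,\<dots>,A\<^sub>l)\<close> are
  exchanged, the condition on the tuple factorises, and the inner sum is a product of binomial
  coefficients \<open>g\<^sub>i(t) choose k\<^sub>i\<close>, where \<open>g\<^sub>i(t) = D (d\<^sub>i + O(P))\<close> counts the integers of the
  \<open>i\<close>-th interval that survive the sieve. The resulting \<open>D^r\<close> cancels the normalising factors
  \<open>(1 - 1/p)^(-r)\<close>. The relative error \<open>P/d\<^sub>i\<close> is a negative power of \<open>h\<close> since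
  \<open>P \<le> 4^y \<le> h^(\<delta>/2)\<close> (\<open>primorial_le\<close>).

  The order of magnitude \<open>log h\<close> for \<open>y\<close> is forced from both sides: \<open>P\<close> has to stay below
  \<open>h^\<delta>\<close>, and \<open>y\<close> has to be at least of order \<open>log h\<close> for the pointwise bound.

  If some of the \<open>A\<^sub>i\<close> meet, the union has fewer than \<open>r\<close> elements and the normalising factor
  \<open>(1 - 1/p)^(-r)\<close> is the wrong one. Then the two quantities compared are both at most \<open>2 y^r\<close>,
  a power of \<open>log h\<close>, while such tuples form a proportion of all tuples which is at most a
  negative power of \<open>h\<close> (\<open>card_overlapping_tuples_le\<close>).
\<close>

section \<open>The primorial\<close>

lemma prod_primes_dvd:
  fixes n :: nat
  assumes "finite E" "\<And>p. p \<in> E \<Longrightarrow> prime p" "\<And>p. p \<in> E \<Longrightarrow> p dvd n"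
  shows "\<Prod>E dvd n"
  using assms
proof (induction E rule: finite_induct)
  case (insert p E)
  have "coprime p (\<Prod>E)"
    using insert.hyps(2) insert.prems(1)
    by (intro prod_coprime_right) (metis insertI1 insertI2 primes_coprime)
  then show ?case using insert by (simp add: divides_mult)
qed simp

text \<open>
  Erdos's argument: for \<open>n = 2 m + 1\<close> every prime in \<open>(m + 1, n]\<close> divides the binomial coefficient
  \<open>n choose m\<close>, which is one of the two equal central terms in a row of sum \<open>2 \<cdot> 4^m\<close>.
\<close>

lemma primorial_le: "\<Prod>{p. prime p \<and> p \<le> n} \<le> (4::nat) ^ n"
proof (induction n rule: less_induct)
  case (less n)
  consider "n \<le> 1" | "n = 2" | "n > 2" "even n" | "n > 2" "odd n" by linarith
  then show ?case
  proof cases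
    case 1
    have empty: "{p::nat. prime p \<and> p \<le> n} = {}"
      using 1 by (auto dest: prime_gt_1_nat)
    show ?thesis unfolding empty by simp
  next
    case 2
    have two: "{p::nat. prime p \<and> p \<le> n} = {2}"
      using 2 by (auto dest: prime_ge_2_nat)
    show ?thesis unfolding two using 2 by simp
  next
    case 3
    then have "\<not> prime n" using prime_odd_nat[of n] by auto
    then have "prime p \<and> p \<le> n \<longleftrightarrow> prime p \<and> p \<le> n - 1" for p
      using 3 by (cases "p = n") auto
    with less.IH[of "n - 1"] 3 have "\<Prod>{p::nat. prime p \<and> p \<le> n} \<le> 4 ^ (n - 1)" by simp
    also have "\<dots> \<le> 4 ^ n" by (rule power_increasing) auto
    finally show ?thesis .
  next
    case 4
    then obtain m where n: "n = 2 * m + 1" and m: "m \<ge> 1" by (auto elim!: oddE)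
    let ?L = "{p::nat. prime p \<and> p \<le> Suc m}"
    let ?U = "{p::nat. prime p \<and> Suc m < p \<and> p \<le> n}"
    have fin: "finite ?L" "finite ?U" by auto
    have split: "{p::nat. prime p \<and> p \<le> n} = ?L \<union> ?U" using m n by auto
    have dvd: "p dvd (n choose m)" if "p \<in> ?U" for p
    proof -
      have "fact m * fact (n - m) * (n choose m) = (fact n :: nat)"
        using n by (intro binomial_fact_lemma) auto
      moreover have "p dvd fact n" using that by (simp add: prime_dvd_fact_iff)
      moreover have "\<not> p dvd fact m" "\<not> p dvd fact (n - m)"
        using that n by (simp_all add: prime_dvd_fact_iff del: fact_Suc)
      ultimately show ?thesis using that by (metis prime_dvd_mult_iff mem_Collect_eq)
    qed
    have "\<Prod>?U dvd (n choose m)" using fin(2) dvd by (intro prod_primes_dvd) auto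
    moreover have "(n choose m) > 0" using n by simp
    ultimately have "\<Prod>?U \<le> (n choose m)" by (rule dvd_imp_le)
    also have "\<dots> \<le> 4 ^ m"
    proof -
      have "(n choose m) + (n choose Suc m) = (\<Sum>k\<in>{m, Suc m}. n choose k)" by simp
      also have "\<dots> \<le> (\<Sum>k\<le>n. n choose k)" using n by (intro sum_mono2) auto
      also have "\<dots> = 2 * 4 ^ m" using choose_row_sum[of n] by (simp add: n power_mult)
      finally show ?thesis using central_binomial_odd[of n] 4 n by simp
    qed
    finally have U: "\<Prod>?U \<le> 4 ^ m" .
    have "\<Prod>{p::nat. prime p \<and> p \<le> n} = \<Prod>?L * \<Prod>?U"
      unfolding split by (rule prod.union_disjoint) auto
    also have "\<dots> \<le> 4 ^ Suc m * 4 ^ m"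
      using less.IH[of "Suc m"] m n U by (intro mult_mono) auto
    also have "\<dots> = 4 ^ n" by (simp add: n power_add mult_2)
    finally show ?thesis .
  qed
qed

section \<open>Shifted sieves\<close>

text \<open>
  The Chinese remainder theorem identifies the set that is counted with the product of the
  sets \<open>S p\<close>.
\<close>

lemma card_residues_in:
  fixes Q :: "nat set" and S :: "nat \<Rightarrow> nat set"
  assumes "finite Q" and prime: "\<And>p. p \<in> Q \<Longrightarrow> prime p"
    and S: "\<And>p. p \<in> Q \<Longrightarrow> S p \<subseteq> {..<p}"
  shows "card {c \<in> {..<\<Prod>Q}. \<forall>p\<in>Q. c mod p \<in> S p} = (\<Prod>p\<in>Q. card (S p))"
proof -
  let ?f = "\<lambda>c. \<lambda>p\<in>Q. c mod p"
  let ?C = "{c \<in> {..<\<Prod>Q}. \<forall>p\<in>Q. c mod p \<in> S p}"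
  have nz: "\<forall>p\<in>Q. p \<noteq> 0" using prime not_prime_0 by metis
  have crt: "\<exists>!x. x < \<Prod>Q \<and> (\<forall>p\<in>Q. [x = u p] (mod p))" for u
    using assms(1) nz by (rule chinese_remainder_unique_nat) (simp add: primes_coprime prime)
  have "bij_betw ?f ?C (PiE Q S)"
  proof (rule bij_betw_imageI)
    show "inj_on ?f ?C"
    proof (rule inj_onI)
      fix x y assume xy: "x \<in> ?C" "y \<in> ?C" "?f x = ?f y"
      have "[y = x] (mod p)" if "p \<in> Q" for p
        using fun_cong[OF xy(3), of p] that by (simp add: cong_def)
      then show "x = y" using crt[of "\<lambda>_. x"] xy(1,2) by (blast intro: cong_refl)
    qed
    show "?f ` ?C = PiE Q S"
    proof (intro equalityI subsetI)
      fix g assume g: "g \<in> PiE Q S"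
      obtain x where x: "x < \<Prod>Q" "\<forall>p\<in>Q. [x = g p] (mod p)" using crt by blast
      have xg: "x mod p = g p" if "p \<in> Q" for p
      proof -
        have "g p < p" using g S[OF that] that by (auto dest: PiE_mem)
        then show ?thesis using x(2) that by (simp add: cong_def)
      qed
      have "?f x = g" by (rule ext) (simp add: restrict_def xg PiE_arb[OF g])
      moreover have "x \<in> ?C" using x(1) by (simp add: xg PiE_mem[OF g])
      ultimately show "g \<in> ?f ` ?C" by blast
    qed auto
  qed
  then show ?thesis using bij_betw_same_card[of ?f ?C "PiE Q S"] by (simp add: card_PiE[OF assms(1)])
qed

definition sifted :: "nat set \<Rightarrow> int \<Rightarrow> int set" where
  "sifted Q c = {n. \<forall>p\<in>Q. \<not> int p dvd n - c}"

text \<open>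
  Modulo \<open>p\<close>, the shift \<open>c\<close> has to avoid exactly the residue classes that \<open>H\<close> occupies.
\<close>

lemma card_translates_containing:
  assumes "finite Q" and prime: "\<And>p. p \<in> Q \<Longrightarrow> prime p"
  shows "card {c \<in> {..<\<Prod>Q}. H \<subseteq> sifted Q (int c)} =
    (\<Prod>p\<in>Q. p - card (occupied_classes H p))"
proof -
  define S where "S p = {..<p} - nat ` occupied_classes H p" for p
  have occ: "occupied_classes H p \<subseteq> {0..<int p}" if "p \<in> Q" for p
    using prime[OF that] prime_gt_0_nat by (auto simp: occupied_classes_def)
  have "H \<subseteq> sifted Q (int c) \<longleftrightarrow> (\<forall>p\<in>Q. c mod p \<in> S p)" for c
  proof -
    have "(\<forall>a\<in>H. \<not> int p dvd a - int c) \<longleftrightarrow> c mod p \<in> S p" if p: "p \<in> Q" for p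
    proof -
      have p0: "p > 0" using prime[OF p] prime_gt_0_nat by blast
      have "c mod p \<in> nat ` occupied_classes H p \<longleftrightarrow> int (c mod p) \<in> occupied_classes H p"
      proof -
        have "c mod p = nat a \<longleftrightarrow> a = int (c mod p)" if "a \<in> occupied_classes H p" for a
          using occ[OF p] that by auto
        then show ?thesis by (simp add: image_iff cong: bex_cong)
      qed
      also have "\<dots> \<longleftrightarrow> (\<exists>a\<in>H. int p dvd a - int c)"
        by (simp add: occupied_classes_def zmod_int image_iff mod_eq_dvd_iff
            dvd_diff_commute[of _ "int c"])
      finally show ?thesis using p0 by (simp add: S_def)
    qed
    then show ?thesis unfolding sifted_def by blast
  qed
  then have "card {c \<in> {..<\<Prod>Q}. H \<subseteq> sifted Q (int c)} = (\<Prod>p\<in>Q. card (S p))"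
    using card_residues_in[OF assms, of S] by (simp add: S_def)
  also have "\<dots> = (\<Prod>p\<in>Q. p - card (occupied_classes H p))"
  proof (rule prod.cong)
    fix p assume p: "p \<in> Q"
    have inj: "inj_on nat (occupied_classes H p)"
      by (rule inj_on_subset[OF _ occ[OF p]]) (auto intro!: inj_onI)
    have sub: "nat ` occupied_classes H p \<subseteq> {..<p}"
      using occ[OF p] by (auto simp: subset_iff nat_less_iff)
    show "card (S p) = p - card (occupied_classes H p)"
      unfolding S_def using card_Diff_subset[OF finite_subset[OF sub] sub] card_image[OF inj] by simp
  qed simp
  finally show ?thesis .
qed

lemma card_residue_class_bounds:
  fixes m :: nat and u :: int and b c :: real
  assumes m: "m > 0" and bc: "b \<le> c"
  defines "J \<equiv> {n::int. real_of_int n \<in> {b..c} \<and> n mod int m = u}"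
  assumes u: "u \<in> {0..<int m}"
  shows "finite J" "\<bar>real (card J) - (c - b) / m\<bar> \<le> 1"
proof -
  have J: "J = (\<lambda>q. int m * q + u) ` {\<lceil>(b - u) / m\<rceil>..\<lfloor>(c - u) / m\<rfloor>}"
  proof (intro equalityI subsetI)
    fix n assume "n \<in> J"
    then have n: "b \<le> n" "n \<le> c" "n mod int m = u" by (auto simp: J_def)
    define q where "q = n div int m"
    have nq: "n = int m * q + u" using n(3) by (auto simp: q_def)
    then have "real_of_int n = real m * q + u" by simp
    with n m have "(b - u) / m \<le> q" "q \<le> (c - u) / m" by (auto simp: field_simps)
    then show "n \<in> (\<lambda>q. int m * q + u) ` {\<lceil>(b - u) / m\<rceil>..\<lfloor>(c - u) / m\<rfloor>}"
      using nq by (auto simp: ceiling_le_iff le_floor_iff)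
  next
    fix n assume "n \<in> (\<lambda>q. int m * q + u) ` {\<lceil>(b - u) / m\<rceil>..\<lfloor>(c - u) / m\<rfloor>}"
    then obtain q where "n = int m * q + u" "q \<in> {\<lceil>(b - u) / m\<rceil>..\<lfloor>(c - u) / m\<rfloor>}"
      by blast
    then have q: "n = int m * q + u" "(b - u) / m \<le> q" "q \<le> (c - u) / m"
      by (simp_all add: ceiling_le_iff le_floor_iff)
    then show "n \<in> J" using m u by (auto simp: J_def field_simps)
  qed
  then show "finite J" by simp
  have "inj_on (\<lambda>q. int m * q + u) X" for X using m by (auto intro!: inj_onI)
  then have card: "card J = nat (\<lfloor>(c - u) / m\<rfloor> - \<lceil>(b - u) / m\<rceil> + 1)"
    unfolding J by (simp add: card_image)
  have "(b - u) / m \<le> (c - u) / m" using bc m by (simp add: divide_right_mono)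
  moreover have "(c - u) / m - (b - u) / m = (c - b) / m" by (simp add: diff_divide_distrib)
  ultimately show "\<bar>real (card J) - (c - b) / m\<bar> \<le> 1"
    unfolding card by linarith
qed

lemma finite_integers_in_interval: "finite {n::int. real_of_int n \<in> {b..c}}"
proof (rule finite_subset)
  show "{n::int. real_of_int n \<in> {b..c}} \<subseteq> {\<lfloor>b\<rfloor>..\<lceil>c\<rceil>}"
    by (auto simp: floor_le_iff le_ceiling_iff)
qed simp

text \<open>
  Membership in \<open>sifted Q t\<close> is periodic modulo \<open>\<Prod>Q\<close>. A period contains
  \<open>\<Prod>p\<in>Q. (p - 1)\<close> admissible residue classes, and the interval meets each of them in
  \<open>(c - b) / \<Prod>Q\<close> integers with an error of at most 1.
\<close>

lemma card_sifted_interval: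
  fixes Q :: "nat set" and b c :: real and t :: int
  assumes Q: "finite Q" and prime: "\<And>p. p \<in> Q \<Longrightarrow> prime p" and bc: "b \<le> c"
  shows "\<bar>real (card ({n. real_of_int n \<in> {b..c}} \<inter> sifted Q t))
           - (\<Prod>p\<in>Q. 1 - 1 / real p) * (c - b)\<bar> \<le> (\<Prod>p\<in>Q. 1 - 1 / real p) * real (\<Prod>Q)"
proof -
  define P where "P = \<Prod>Q"
  have P0: "P > 0" unfolding P_def using Q prime prime_gt_0_nat by (simp add: prod_pos)
  define V where "V = {v \<in> {..<P}. t \<in> sifted Q (int v)}"
  have occ: "occupied_classes {t} p = {t mod int p}" for p by (simp add: occupied_classes_def)
  have "card V = (\<Prod>p\<in>Q. p - 1)"
    using card_translates_containing[OF Q prime, of "{t}"] by (simp add: occ V_def P_def)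
  also have "real \<dots> = (\<Prod>p\<in>Q. real p * (1 - 1 / real p))"
    unfolding of_nat_prod
  proof (rule prod.cong)
    fix p assume "p \<in> Q"
    with prime have "p > 0" using prime_gt_0_nat by blast
    then show "real (p - 1) = real p * (1 - 1 / real p)" by (simp add: field_simps of_nat_diff)
  qed simp
  finally have V: "real (card V) = real P * (\<Prod>p\<in>Q. 1 - 1 / real p)"
    by (simp add: P_def prod.distrib)
  define J where "J v = {n::int. real_of_int n \<in> {b..c} \<and> n mod int P = int v}" for v
  have J: "finite (J v)" "\<bar>real (card (J v)) - (c - b) / P\<bar> \<le> 1" if "v \<in> V" for v
    using card_residue_class_bounds[OF P0 bc, of "int v"] that by (auto simp: V_def J_def)
  have sift: "n \<in> sifted Q t \<longleftrightarrow> t \<in> sifted Q (n mod int P)" for n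
  proof -
    have "int p dvd n - t \<longleftrightarrow> int p dvd t - n mod int P" if "p \<in> Q" for p
    proof -
      have "int p dvd int P" unfolding P_def using that Q by (simp add: dvd_prodI int_dvd_int_iff)
      then have "n mod int P mod int p = n mod int p" by (rule mod_mod_cancel)
      then show ?thesis by (metis mod_eq_dvd_iff)
    qed
    then show ?thesis by (auto simp: sifted_def)
  qed
  have "{n. real_of_int n \<in> {b..c}} \<inter> sifted Q t = (\<Union>v\<in>V. J v)"
  proof (intro equalityI subsetI)
    fix n assume n: "n \<in> {n. real_of_int n \<in> {b..c}} \<inter> sifted Q t"
    have "nat (n mod int P) \<in> V"
      using n sift[of n] P0 by (auto simp: V_def nat_less_iff)
    moreover have "n \<in> J (nat (n mod int P))" using n P0 by (auto simp: J_def)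
    ultimately show "n \<in> (\<Union>v\<in>V. J v)" by blast
  next
    fix n assume "n \<in> (\<Union>v\<in>V. J v)"
    then show "n \<in> {n. real_of_int n \<in> {b..c}} \<inter> sifted Q t"
      using sift[of n] by (auto simp: V_def J_def)
  qed
  also have "card \<dots> = (\<Sum>v\<in>V. card (J v))"
    by (rule card_UN_disjoint) (use J(1) in \<open>auto simp: V_def J_def\<close>)
  finally have card: "real (card ({n. real_of_int n \<in> {b..c}} \<inter> sifted Q t)) = (\<Sum>v\<in>V. real (card (J v)))"
    by simp
  have "(\<Prod>p\<in>Q. 1 - 1 / real p) * (c - b) = (\<Sum>v\<in>V. (c - b) / P)"
    using P0 V by simp
  then have "\<bar>real (card ({n. real_of_int n \<in> {b..c}} \<inter> sifted Q t)) - (\<Prod>p\<in>Q. 1 - 1 / real p) * (c - b)\<bar>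
      = \<bar>\<Sum>v\<in>V. real (card (J v)) - (c - b) / P\<bar>"
    using card by (simp add: sum_subtractf)
  also have "\<dots> \<le> (\<Sum>v\<in>V. 1)"
    by (rule order.trans[OF sum_abs]) (intro sum_mono J(2))
  also have "\<dots> = (\<Prod>p\<in>Q. 1 - 1 / real p) * real P" using V by simp
  finally show ?thesis by (simp add: P_def)
qed

section \<open>Pointwise estimates for the Euler product\<close>

definition euler_factor :: "int set \<Rightarrow> nat \<Rightarrow> real" where
  "euler_factor H p = (if prime p
     then (1 - real (card (occupied_classes H p)) / real p) * (1 - 1 / real p) powi (- int (card H))
     else 1)"

lemma euler_factor_prime:
  assumes "prime p"
  shows "euler_factor H p =
    (1 - real (card (occupied_classes H p)) / real p) / (1 - 1 / real p) ^ card H"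
  using assms by (simp add: euler_factor_def power_int_minus divide_inverse)

lemma occupied_classes_bounds:
  assumes "finite H" "p > 0"
  shows "card (occupied_classes H p) \<le> card H" "card (occupied_classes H p) \<le> p"
proof -
  show "card (occupied_classes H p) \<le> card H"
    unfolding occupied_classes_def by (rule card_image_le[OF assms(1)])
  have "occupied_classes H p \<subseteq> {0..<int p}" using assms(2) by (auto simp: occupied_classes_def)
  then show "card (occupied_classes H p) \<le> p" using card_mono[of "{0..<int p}"] by fastforce
qed

lemma euler_factor_nonneg:
  assumes "finite H"
  shows "euler_factor H p \<ge> 0"
proof (cases "prime p")
  case True
  then show ?thesis
    using occupied_classes_bounds(2)[OF assms, of p] prime_gt_1_nat[OF True]
    by (simp add: euler_factor_prime)
qed (simp add: euler_factor_def)

text \<open>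
  The bound for the smallest possible factor \<open>(1 - s/p) (1 - 1/p)^(-s)\<close>, where \<open>s\<close> is the size
  of \<open>H\<close>: the inverse power is at least \<open>(1 + 1/p)^s \<ge> 1 + s/p\<close>, and
  \<open>(1 - s/p) (1 + s/p) = 1 - s\<^sup>2/p\<^sup>2\<close>. The terms of order \<open>1/p\<close> cancel.
\<close>

lemma euler_factor_ge:
  assumes "finite H" "p > 0"
  shows "euler_factor H p \<ge> 1 - (real (card H))\<^sup>2 / (real p)\<^sup>2"
proof (cases "prime p")
  case True
  let ?s = "real (card H)"
  have p: "real p > 1" using prime_gt_1_nat[OF True] by simp
  show ?thesis
  proof (cases "?s \<le> p")
    case s: True
    have "1 - ?s\<^sup>2 / (real p)\<^sup>2 = (1 - ?s / p) * (1 + card H * (1 / real p))"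
      using p by (simp add: field_simps power2_eq_square)
    also have "\<dots> \<le> (1 - ?s / p) * (1 + 1 / real p) ^ card H"
      using s p Bernoulli_inequality[of "1 / real p" "card H"]
      by (intro mult_left_mono) (auto simp: field_simps)
    also have "\<dots> \<le> (1 - ?s / p) * (1 / (1 - 1 / real p)) ^ card H"
      using s p by (intro mult_left_mono power_mono) (auto simp: field_simps)
    also have "\<dots> = (1 - ?s / p) / (1 - 1 / real p) ^ card H"
      by (simp add: power_one_over)
    also have "\<dots> \<le> euler_factor H p"
      unfolding euler_factor_prime[OF True]
      using occupied_classes_bounds(1)[OF assms] p
      by (intro divide_right_mono diff_left_mono) auto
    finally show ?thesis .
  next
    case False
    then have "1 \<le> ?s\<^sup>2 / (real p)\<^sup>2" using p by (simp add: power_mono)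
    then show ?thesis using euler_factor_nonneg[OF assms(1), of p] by linarith
  qed
qed (simp add: euler_factor_def)

text \<open>
  This is Bernoulli's inequality \<open>1 - s/p \<le> (1 - 1/p)^s\<close>.
\<close>

lemma euler_factor_le_1:
  assumes "card (occupied_classes H p) = card H"
  shows "euler_factor H p \<le> 1"
proof (cases "prime p")
  case True
  have p: "real p > 1" using prime_gt_1_nat[OF True] by simp
  have "1 - real (card H) / p \<le> (1 - 1 / real p) ^ card H"
    using Bernoulli_inequality[of "- 1 / real p" "card H"] p by simp
  then show ?thesis using p by (simp add: euler_factor_prime[OF True] assms divide_le_eq_1)
qed (simp add: euler_factor_def)

lemma euler_factor_le_exp:
  assumes "card H \<le> r" "y > 0" "p > y"
  shows "euler_factor H p \<le> exp (real r / real y)"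
proof (cases "prime p")
  case True
  have p: "real p > 1" using prime_gt_1_nat[OF True] by simp
  have yp: "real y \<le> real p - 1" "real y > 0" using assms(2,3) by auto
  have "euler_factor H p \<le> 1 / (1 - 1 / real p) ^ card H"
    unfolding euler_factor_prime[OF True] using p by (intro divide_right_mono) auto
  also have "\<dots> = (1 + 1 / (real p - 1)) ^ card H"
    using p by (simp add: field_simps flip: power_one_over power_divide)
  also have "\<dots> \<le> (1 + 1 / (real p - 1)) ^ r"
    using assms(1) p by (intro power_increasing) auto
  also have "\<dots> \<le> (1 + 1 / real y) ^ r"
    using yp by (intro power_mono add_left_mono divide_left_mono) auto
  also have "\<dots> \<le> exp (1 / real y) ^ r"
    using yp by (intro power_mono exp_ge_add_one_self) auto
  also have "\<dots> = exp (real r / real y)" by (simp flip: exp_of_nat_mult)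
  finally show ?thesis .
qed (simp add: euler_factor_def)

lemma occupied_classes_eq_card:
  assumes "finite H" "\<And>a b. a \<in> H \<Longrightarrow> b \<in> H \<Longrightarrow> a \<noteq> b \<Longrightarrow> \<not> int p dvd a - b"
  shows "card (occupied_classes H p) = card H"
  unfolding occupied_classes_def
  by (rule card_image) (meson assms(2) inj_onI mod_eq_dvd_iff)

text \<open>
  The product of these primes divides \<open>d\<close>, and each of them exceeds \<open>y\<close>.
\<close>

lemma card_prime_divisors_le:
  fixes d :: int and y :: nat and X :: real
  assumes "d \<noteq> 0" "\<bar>real_of_int d\<bar> \<le> X" "y > 1"
  defines "D \<equiv> {p. prime p \<and> y < p \<and> int p dvd d}"
  shows "finite D" "real (card D) \<le> ln X / ln y"
proof -
  have "p \<le> nat \<bar>d\<bar>" if "int p dvd d" for p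
    using dvd_imp_le_int[OF assms(1) that] by linarith
  then have "D \<subseteq> {..nat \<bar>d\<bar>}" by (auto simp: D_def)
  then show fin: "finite D" by (rule finite_subset) simp
  have "\<Prod>D dvd nat \<bar>d\<bar>" using fin by (intro prod_primes_dvd) (auto simp: D_def)
  then have "\<Prod>D \<le> nat \<bar>d\<bar>" using assms(1) by (intro dvd_imp_le) auto
  moreover have "y ^ card D \<le> \<Prod>D"
    using prod_mono[of D "\<lambda>_. y" "\<lambda>p. p"] by (auto simp: D_def)
  ultimately have "int (y ^ card D) \<le> \<bar>d\<bar>" by linarith
  then have "real_of_int (int (y ^ card D)) \<le> \<bar>real_of_int d\<bar>" by linarith
  then have yX: "real y ^ card D \<le> X" using assms(2) by simp
  moreover have "0 < real y ^ card D" using assms(3) by simp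
  ultimately have "ln (real y ^ card D) \<le> ln X" by (subst ln_le_cancel_iff) linarith+
  then have "real (card D) * ln y \<le> ln X" using assms(3) by (simp add: ln_realpow)
  then show "real (card D) \<le> ln X / ln y" using assms(3) by (simp add: field_simps)
qed

lemma sum_inverse_squares_le:
  assumes "y > 0"
  shows "(\<Sum>n\<in>{y<..N}. 1 / (real n)\<^sup>2) \<le> 1 / real y"
proof (cases "y \<le> N")
  case True
  then have "(\<Sum>n\<in>{y<..N}. 1 / (real n)\<^sup>2) \<le> 1 / real y - 1 / real N"
  proof (induction N rule: dec_induct)
    case (step M)
    have M: "real M > 0" using assms step by simp
    have "{y<..Suc M} = insert (Suc M) {y<..M}" using step by auto
    then have "(\<Sum>n\<in>{y<..Suc M}. 1 / (real n)\<^sup>2) = 1 / (real (Suc M))\<^sup>2 + (\<Sum>n\<in>{y<..M}. 1 / (real n)\<^sup>2)"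
      by simp
    moreover have "1 / (real (Suc M))\<^sup>2 \<le> 1 / (real M * real (Suc M))"
      using M by (intro divide_left_mono) (auto simp: power2_eq_square)
    moreover have "1 / (real M * real (Suc M)) = 1 / real M - 1 / real (Suc M)"
      using M by (simp add: field_simps)
    ultimately show ?case using step.IH by linarith
  qed simp
  moreover have "0 \<le> 1 / real N" by simp
  ultimately show ?thesis by linarith
qed simp

lemma euler_product_segment_ge:
  assumes H: "finite H" and y: "y > 0" "card H \<le> y"
  shows "1 - (real (card H))\<^sup>2 / y \<le> (\<Prod>p\<in>{y<..N}. euler_factor H p)"
proof -
  let ?s = "real (card H)"
  have f: "?s\<^sup>2 / (real p)\<^sup>2 \<in> {0..1}" if "p \<in> {y<..N}" for p
    using that y by (auto intro!: divide_le_eq_1_pos[THEN iffD2] power_mono)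
  have "?s\<^sup>2 * (\<Sum>p\<in>{y<..N}. 1 / (real p)\<^sup>2) \<le> ?s\<^sup>2 * (1 / y)"
    using sum_inverse_squares_le[OF y(1)] by (rule mult_left_mono) simp
  then have "1 - ?s\<^sup>2 / y \<le> 1 - (\<Sum>p\<in>{y<..N}. ?s\<^sup>2 / (real p)\<^sup>2)" by (simp add: sum_distrib_left)
  also have "\<dots> \<le> (\<Prod>p\<in>{y<..N}. 1 - ?s\<^sup>2 / (real p)\<^sup>2)"
    by (rule Weierstrass_prod_ineq[OF f])
  also have "\<dots> \<le> (\<Prod>p\<in>{y<..N}. euler_factor H p)"
    using f euler_factor_ge[OF H] by (intro prod_mono) auto
  finally show ?thesis .
qed

text \<open>
  Only primes that divide a difference of two elements of \<open>H\<close> have a factor above 1. There are at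
  most \<open>r\<^sup>2\<close> pairs of elements, each with at most \<open>ln X / ln y\<close> prime divisors above \<open>y\<close>, and every
  such prime costs at most \<open>exp(r/y)\<close>.
\<close>

lemma euler_product_segment_le:
  assumes H: "finite H" "card H \<le> r" and y: "y > 1"
    and X: "X \<ge> 1" "\<And>a b. a \<in> H \<Longrightarrow> b \<in> H \<Longrightarrow> \<bar>real_of_int (a - b)\<bar> \<le> X"
  shows "(\<Prod>p\<in>{y<..N}. euler_factor H p) \<le> exp (real r ^ 3 * ln X / (y * ln y))"
proof -
  define Z where "Z = {(a, b). a \<in> H \<and> b \<in> H \<and> a \<noteq> b}"
  define D where "D = (\<Union>(a, b)\<in>Z. {p. prime p \<and> y < p \<and> int p dvd a - b})"
  have "Z \<subseteq> H \<times> H" by (auto simp: Z_def)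
  then have Z: "finite Z" "card Z \<le> card H * card H"
    using H(1) finite_subset card_mono[of "H \<times> H" Z] by (auto simp: card_cartesian_product)
  have lny: "ln (real y) > 0" using y by simp
  have L0: "ln X / ln y \<ge> 0" using X(1) lny by simp
  have pair: "finite {p. prime p \<and> y < p \<and> int p dvd fst z - snd z}"
      "real (card {p. prime p \<and> y < p \<and> int p dvd fst z - snd z}) \<le> ln X / ln y"
    if "z \<in> Z" for z
    using that card_prime_divisors_le[of "fst z - snd z" X y] X(2) y by (auto simp: Z_def)
  have D: "D = (\<Union>z\<in>Z. {p. prime p \<and> y < p \<and> int p dvd fst z - snd z})"
    by (auto simp: D_def)
  have finD: "finite D" unfolding D using Z(1) pair(1) by blast
  have "card D \<le> (\<Sum>z\<in>Z. card {p. prime p \<and> y < p \<and> int p dvd fst z - snd z})"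
    unfolding D by (rule card_UN_le[OF Z(1)])
  then have "real (card D) \<le> (\<Sum>z\<in>Z. real (card {p. prime p \<and> y < p \<and> int p dvd fst z - snd z}))"
    by (simp flip: of_nat_sum)
  also have "\<dots> \<le> (\<Sum>z\<in>Z. ln X / ln y)" by (intro sum_mono pair(2))
  also have "\<dots> = real (card Z) * (ln X / ln y)" by simp
  also have "\<dots> \<le> real (r * r) * (ln X / ln y)"
    using Z(2) mult_le_mono[OF H(2) H(2)] L0 by (intro mult_right_mono) (simp_all only: of_nat_le_iff)
  finally have cardD: "real (card D) \<le> real (r * r) * (ln X / ln y)" .
  have "(\<Prod>p\<in>{y<..N}. euler_factor H p) \<le> (\<Prod>p\<in>{y<..N}. if p \<in> D then exp (real r / y) else 1)"
  proof (intro prod_mono conjI)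
    fix p assume p: "p \<in> {y<..N}"
    show "euler_factor H p \<le> (if p \<in> D then exp (real r / y) else 1)"
    proof (cases "p \<in> D")
      case True
      then show ?thesis using euler_factor_le_exp[OF H(2), of y p] y p by simp
    next
      case False
      show ?thesis
      proof (cases "prime p")
        case True
        then have "card (occupied_classes H p) = card H"
          using False p by (intro occupied_classes_eq_card[OF H(1)]) (auto simp: D_def Z_def)
        then show ?thesis using euler_factor_le_1 False by simp
      qed (simp add: euler_factor_def)
    qed
  qed (rule euler_factor_nonneg[OF H(1)])
  also have "\<dots> = exp (real r / y) ^ card ({y<..N} \<inter> D)"
    by (simp add: prod.If_cases)
  also have "\<dots> \<le> exp (real r / y) ^ card D"
    using finD by (intro power_increasing card_mono) auto
  also have "\<dots> = exp (real (card D) * (real r / y))" by (simp flip: exp_of_nat_mult)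
  also have "\<dots> \<le> exp (real (r * r) * (ln X / ln y) * (real r / y))"
    by (intro exp_le_cancel_iff[THEN iffD2] mult_right_mono cardD) simp
  also have "real (r * r) * (ln X / ln y) * (real r / y) = real r ^ 3 * ln X / (y * ln y)"
    by (simp add: power3_eq_cube mult.commute)
  finally show ?thesis .
qed

lemma convergent_euler_product:
  assumes H: "finite H"
  shows "convergent_prod (euler_factor H)"
proof -
  \<comment> \<open>Above the largest difference of elements of H, all classes are distinct and the factor is \<open>1 + O(1/p^2)\<close>.\<close>
  define M where "M = Max (insert 1 ((\<lambda>(a, b). \<bar>a - b\<bar>) ` (H \<times> H)))"
  have M: "\<bar>a - b\<bar> \<le> M" if "a \<in> H" "b \<in> H" for a b
    unfolding M_def by (rule Max_ge) (use H that in force)+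
  have bound: "norm (euler_factor H p - 1) \<le> (real (card H))\<^sup>2 * (1 / (real p)\<^sup>2)" if p: "p > nat M" for p
  proof -
    have "\<not> int p dvd a - b" if "a \<in> H" "b \<in> H" "a \<noteq> b" for a b
      using dvd_imp_le_int[of "a - b" "int p"] M[OF that(1,2)] that(3) p by auto
    then have "euler_factor H p \<le> 1"
      using occupied_classes_eq_card[OF H] by (intro euler_factor_le_1) blast
    then show ?thesis using euler_factor_ge[OF H, of p] p by simp
  qed
  have "summable (\<lambda>p. (real (card H))\<^sup>2 * (1 / (real p)\<^sup>2))"
    using inverse_power_summable[of 2, where 'a = real]
    by (intro summable_mult) (simp add: inverse_eq_divide)
  then have "summable (\<lambda>p. norm (euler_factor H p - 1))"
    by (rule summable_comparison_test_ev[rotated])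
      (use bound in \<open>auto simp: eventually_sequentially intro!: exI[of _ "Suc (nat M)"]\<close>)
  then show ?thesis
    by (intro abs_convergent_prod_imp_convergent_prod) (simp add: abs_convergent_prod_conv_summable)
qed

text \<open>
  The bounds for the segments \<open>(y, N]\<close> are uniform in \<open>N\<close> and so pass to the limit.
\<close>

lemma singular_series_bounds:
  assumes H: "finite H" "card H \<le> r" and y: "y > 1" "r \<le> y"
    and X: "X \<ge> 1" "\<And>a b. a \<in> H \<Longrightarrow> b \<in> H \<Longrightarrow> \<bar>real_of_int (a - b)\<bar> \<le> X"
  defines "T \<equiv> (\<Prod>p\<le>y. euler_factor H p)"
  shows "(1 - (real r)\<^sup>2 / y) * T \<le> singular_series H"
    and "singular_series H \<le> exp (real r ^ 3 * ln X / (y * ln y)) * T"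
proof -
  have lim: "(\<lambda>N. \<Prod>p\<le>N. euler_factor H p) \<longlonglongrightarrow> singular_series H"
    using convergent_prod_LIMSEQ[OF convergent_euler_product[OF H(1)]]
    by (simp add: singular_series_def euler_factor_def[abs_def])
  have T0: "T \<ge> 0" unfolding T_def using euler_factor_nonneg[OF H(1)] by (intro prod_nonneg) auto
  have split: "(\<Prod>p\<le>N. euler_factor H p) = (\<Prod>p\<in>{y<..N}. euler_factor H p) * T" if "N \<ge> y" for N
  proof -
    have "{..N} = {y<..N} \<union> {..y}" using that by auto
    then show ?thesis unfolding T_def by (simp only:) (rule prod.union_disjoint, auto)
  qed
  have "(1 - (real r)\<^sup>2 / y) * T \<le> (\<Prod>p\<le>N. euler_factor H p)" if "N \<ge> y" for N
  proof -
    have "1 - (real r)\<^sup>2 / y \<le> 1 - (real (card H))\<^sup>2 / y"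
      using H(2) by (simp add: divide_right_mono power_mono)
    also have "\<dots> \<le> (\<Prod>p\<in>{y<..N}. euler_factor H p)"
      using H y by (intro euler_product_segment_ge) auto
    finally show ?thesis unfolding split[OF that] using T0 by (rule mult_right_mono)
  qed
  then show "(1 - (real r)\<^sup>2 / y) * T \<le> singular_series H" by (intro LIMSEQ_le_const[OF lim]) blast
  have "(\<Prod>p\<le>N. euler_factor H p) \<le> exp (real r ^ 3 * ln X / (y * ln y)) * T" if "N \<ge> y" for N
    unfolding split[OF that]
    using euler_product_segment_le[OF H y(1) X] T0 by (intro mult_right_mono) auto
  then show "singular_series H \<le> exp (real r ^ 3 * ln X / (y * ln y)) * T"
    by (intro LIMSEQ_le_const2[OF lim]) blast
qed

section \<open>Averaging the truncated Euler product\<close>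

definition primes_upto :: "nat \<Rightarrow> nat set" where
  "primes_upto y = {p. prime p \<and> p \<le> y}"

definition sieve_density :: "nat set \<Rightarrow> real" where
  "sieve_density Q = (\<Prod>p\<in>Q. 1 - 1 / real p)"

text \<open>
  The Euler product of \<open>H\<close> over the primes in \<open>Q\<close>, but normalised with a fixed exponent \<open>r\<close> in
  place of the size of \<open>H\<close>. For unions of \<open>l\<close> sets the size depends on the overlaps; with a fixed
  exponent the sum over all tuples can be evaluated without regard to them.
\<close>

definition sieve_weight :: "nat \<Rightarrow> nat set \<Rightarrow> int set \<Rightarrow> real" where
  "sieve_weight r Q H =
     (\<Prod>p\<in>Q. 1 - real (card (occupied_classes H p)) / real p) / sieve_density Q ^ r"

lemma finite_primes_upto [simp]: "finite (primes_upto y)"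
  by (simp add: primes_upto_def)

lemma primes_uptoD: "p \<in> primes_upto y \<Longrightarrow> prime p"
  by (simp add: primes_upto_def)

lemma sieve_density_bounds:
  assumes "finite Q" "\<And>p. p \<in> Q \<Longrightarrow> prime p"
  shows "sieve_density Q > 0" "sieve_density Q \<le> 1" "sieve_density Q * real (\<Prod>Q) \<ge> 1"
proof -
  have p: "real p \<ge> 2" if "p \<in> Q" for p using prime_ge_2_nat[OF assms(2)[OF that]] by simp
  have f: "0 < 1 - 1 / real p" "1 - 1 / real p \<le> 1" "1 \<le> (1 - 1 / real p) * real p" if "p \<in> Q" for p
    using p[OF that] by (auto simp: field_simps)
  show "sieve_density Q > 0" unfolding sieve_density_def using f by (intro prod_pos) auto
  show "sieve_density Q \<le> 1" unfolding sieve_density_def using f by (intro prod_le_1) (auto simp: less_imp_le)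
  have "sieve_density Q * real (\<Prod>Q) = (\<Prod>p\<in>Q. (1 - 1 / real p) * real p)"
    by (simp add: sieve_density_def prod.distrib)
  also have "\<dots> \<ge> 1" using f(3) by (intro prod_ge_1)
  finally show "sieve_density Q * real (\<Prod>Q) \<ge> 1" .
qed

text \<open>
  The product over all integers from 2 to \<open>y\<close> telescopes to \<open>1/y\<close>, and it has additional factors
  below 1.
\<close>

lemma sieve_density_primes_upto_ge:
  assumes "y > 0"
  shows "sieve_density (primes_upto y) \<ge> 1 / real y"
proof -
  have "1 / real y = (\<Prod>n\<in>{2..y}. 1 - 1 / real n)"
  proof -
    have "1 \<le> y" using assms by simp
    then show ?thesis
    proof (induction y rule: dec_induct)
      case (step m)
      have "{2..Suc m} = insert (Suc m) {2..m}" using step.hyps by auto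
      then have "(\<Prod>n\<in>{2..Suc m}. 1 - 1 / real n) = (1 - 1 / real (Suc m)) * (1 / real m)"
        using step.IH[symmetric] by simp
      also have "\<dots> = 1 / real (Suc m)" using step.hyps by (simp add: field_simps)
      finally show ?case by (rule sym)
    qed simp
  qed
  also have "\<dots> \<le> (\<Prod>n\<in>primes_upto y. 1 - 1 / real n)"
  proof -
    have sub: "primes_upto y \<subseteq> {2..y}" by (auto simp: primes_upto_def dest: prime_ge_2_nat)
    have "(\<Prod>n\<in>{2..y}. 1 - 1 / real n) \<le> (\<Prod>n\<in>{2..y}. if n \<in> primes_upto y then 1 - 1 / real n else 1)"
      by (intro prod_mono) auto
    also have "\<dots> = (\<Prod>n\<in>primes_upto y. 1 - 1 / real n)"
      using sub by (simp add: prod.If_cases Int_absorb1)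
    finally show ?thesis .
  qed
  finally show ?thesis by (simp add: sieve_density_def)
qed

lemma local_factor_bounds:
  assumes "finite H" "p > 0"
  shows "0 \<le> 1 - real (card (occupied_classes H p)) / real p"
    and "1 - real (card (occupied_classes H p)) / real p \<le> 1"
  using occupied_classes_bounds(2)[OF assms] assms(2) by auto

lemma sieve_weight_bounds:
  assumes "finite H"
  shows "0 \<le> sieve_weight r (primes_upto y) H"
    and "y > 0 \<Longrightarrow> sieve_weight r (primes_upto y) H \<le> real y ^ r"
proof -
  let ?N = "\<Prod>p\<in>primes_upto y. 1 - real (card (occupied_classes H p)) / real p"
  have f: "0 \<le> 1 - real (card (occupied_classes H p)) / real p \<and>
      1 - real (card (occupied_classes H p)) / real p \<le> 1" if "p \<in> primes_upto y" for p
    using local_factor_bounds[OF assms prime_gt_0_nat[OF primes_uptoD[OF that]]] by simp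
  have N: "0 \<le> ?N" "?N \<le> 1" using f by (auto intro!: prod_nonneg prod_le_1)
  have D: "sieve_density (primes_upto y) > 0"
    by (rule sieve_density_bounds(1)[OF finite_primes_upto primes_uptoD])
  show "0 \<le> sieve_weight r (primes_upto y) H"
    unfolding sieve_weight_def using N D by simp
  assume y: "y > 0"
  have "sieve_weight r (primes_upto y) H \<le> 1 / sieve_density (primes_upto y) ^ r"
    unfolding sieve_weight_def using N D by (intro divide_right_mono) auto
  also have "\<dots> \<le> 1 / (1 / real y) ^ r"
    using sieve_density_primes_upto_ge[OF y] y D by (intro divide_left_mono power_mono mult_pos_pos) auto
  also have "\<dots> = real y ^ r" by (simp add: power_one_over)
  finally show "sieve_weight r (primes_upto y) H \<le> real y ^ r" .
qed

lemma euler_product_eq_sieve_weight: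
  "(\<Prod>p\<le>y. euler_factor H p) = sieve_weight (card H) (primes_upto y) H"
proof -
  have "(\<Prod>p\<le>y. euler_factor H p) = (\<Prod>p\<in>primes_upto y. euler_factor H p)"
    by (rule prod.mono_neutral_right) (auto simp: primes_upto_def euler_factor_def)
  also have "\<dots> = (\<Prod>p\<in>primes_upto y.
      (1 - real (card (occupied_classes H p)) / real p) / (1 - 1 / real p) ^ card H)"
    by (intro prod.cong) (simp_all add: euler_factor_prime primes_uptoD)
  finally show ?thesis
    by (simp add: prod_dividef sieve_weight_def sieve_density_def prod_power_distrib)
qed

lemma sieve_weight_mono:
  assumes "finite H" "s \<le> r"
  shows "sieve_weight s (primes_upto y) H \<le> sieve_weight r (primes_upto y) H"
proof -
  let ?D = "sieve_density (primes_upto y)"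
  have D: "0 < ?D" "?D \<le> 1" using sieve_density_bounds(1,2)[OF finite_primes_upto primes_uptoD, of y] by auto
  have "0 \<le> sieve_weight 0 (primes_upto y) H" by (rule sieve_weight_bounds(1)[OF assms(1)])
  then show ?thesis unfolding sieve_weight_def
    using D assms(2) by (intro divide_left_mono power_decreasing) (auto simp: zero_less_mult_iff)
qed

lemma sieve_weight_eq_average:
  assumes Q: "finite Q" "\<And>p. p \<in> Q \<Longrightarrow> prime p" and H: "finite H"
  shows "sieve_weight r Q H =
    (\<Sum>t<\<Prod>Q. if H \<subseteq> sifted Q (int t) then 1 else 0) / (real (\<Prod>Q) * sieve_density Q ^ r)"
proof -
  have P: "real (\<Prod>Q) > 0" using Q prime_gt_0_nat by (auto intro!: prod_pos)
  have "(\<Sum>t<\<Prod>Q. if H \<subseteq> sifted Q (int t) then 1 else (0::real))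
      = real (card {t \<in> {..<\<Prod>Q}. H \<subseteq> sifted Q (int t)})"
    by (simp flip: sum.inter_filter)
  also have "\<dots> = (\<Prod>p\<in>Q. real (p - card (occupied_classes H p)))"
    by (simp only: card_translates_containing[OF Q] of_nat_prod)
  also have "\<dots> = (\<Prod>p\<in>Q. real p * (1 - real (card (occupied_classes H p)) / real p))"
  proof (rule prod.cong)
    fix p assume "p \<in> Q"
    then have "p > 0" using Q(2) prime_gt_0_nat by blast
    then show "real (p - card (occupied_classes H p)) =
        real p * (1 - real (card (occupied_classes H p)) / real p)"
      using occupied_classes_bounds(2)[OF H, of p] by (simp add: of_nat_diff field_simps)
  qed simp
  finally show ?thesis using P by (simp add: sieve_weight_def prod.distrib)
qed

lemma binomial_fact_bounds:
  fixes N k :: nat and a :: real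
  shows "fact k * real (N choose k) \<le> real N ^ k"
    and "0 \<le> a \<Longrightarrow> a \<le> real N - real k \<Longrightarrow> a ^ k \<le> fact k * real (N choose k)"
proof -
  have "real ((N choose k) * fact k) \<le> real (N ^ k)"
    by (simp only: of_nat_le_iff binomial_fact_pow)
  then show "fact k * real (N choose k) \<le> real N ^ k" by (simp add: mult.commute)
  assume a: "0 \<le> a" "a \<le> real N - real k"
  have "a ^ k = (\<Prod>i=0..<k. a)" by simp
  also have "\<dots> \<le> (\<Prod>i=0..<k. real N - real i)"
    using a by (intro prod_mono) auto
  also have "\<dots> = fact k * real (N choose k)"
    by (simp add: binomial_gbinomial gbinomial_prod_rev)
  finally show "a ^ k \<le> fact k * real (N choose k)" .
qed

text \<open>
  By \<open>card_sifted_interval\<close>, \<open>g\<close> differs from \<open>D (c - b)\<close> by at most \<open>D \<Prod>Q \<le> D u (c - b)\<close>. The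
  falling factorial \<open>fact k * (g choose k)\<close> lies between \<open>(g - k)^k\<close> and \<open>g^k\<close>; the loss of \<open>k\<close>
  is absorbed into \<open>k u D (c - b)\<close> because \<open>D \<Prod>Q \<ge> 1\<close>.
\<close>

lemma binomial_sifted_interval_bounds:
  fixes Q :: "nat set" and t :: int and b c u :: real
  assumes Q: "finite Q" "\<And>p. p \<in> Q \<Longrightarrow> prime p" and bc: "b \<le> c"
    and u: "real (\<Prod>Q) \<le> u * (c - b)" "(1 + real k) * u \<le> 1"
  defines "g \<equiv> card ({n. real_of_int n \<in> {b..c}} \<inter> sifted Q t)"
  shows "(sieve_density Q * (c - b)) ^ k * (1 - (1 + real k) * u) ^ k \<le> fact k * real (g choose k)"
    and "fact k * real (g choose k) \<le> (sieve_density Q * (c - b)) ^ k * (1 + u) ^ k"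
proof -
  let ?D = "sieve_density Q" and ?P = "real (\<Prod>Q)" and ?d = "c - b"
  have D: "?D > 0" "?D * ?P \<ge> 1" using sieve_density_bounds[OF Q] by auto
  have g: "\<bar>real g - ?D * ?d\<bar> \<le> ?D * ?P"
    using card_sifted_interval[OF Q bc, of t] by (simp add: g_def sieve_density_def)
  have Pu: "?D * ?P \<le> ?D * (u * ?d)" using u(1) D by (intro mult_left_mono) auto
  then have Pk: "real k \<le> real k * (?D * (u * ?d))"
    using D(2) mult_left_mono[of 1 "?D * (u * ?d)" "real k"] by simp
  have "(?D * ?d * (1 - (1 + real k) * u)) ^ k \<le> fact k * real (g choose k)"
  proof (rule binomial_fact_bounds(2))
    show "0 \<le> ?D * ?d * (1 - (1 + real k) * u)" using D(1) bc u(2) by simp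
    show "?D * ?d * (1 - (1 + real k) * u) \<le> real g - real k"
      using g Pu Pk by (simp add: algebra_simps)
  qed
  then show "(?D * ?d) ^ k * (1 - (1 + real k) * u) ^ k \<le> fact k * real (g choose k)"
    by (simp only: power_mult_distrib)
  have "real g \<le> ?D * ?d * (1 + u)" using g Pu by (simp add: algebra_simps)
  then have "real g ^ k \<le> (?D * ?d * (1 + u)) ^ k" by (rule power_mono) simp
  then show "fact k * real (g choose k) \<le> (?D * ?d) ^ k * (1 + u) ^ k"
    using binomial_fact_bounds(1)[of k g] by (simp only: power_mult_distrib)
qed

lemma subsets_of_size_Int:
  "{A \<in> subsets_of_size b c k. A \<subseteq> S} = {A. A \<subseteq> {n. real_of_int n \<in> {b..c}} \<inter> S \<and> card A = k}"
  by (auto simp: subsets_of_size_def)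

lemma card_subsets_of_size_Int:
  "card {A \<in> subsets_of_size b c k. A \<subseteq> S} = card ({n. real_of_int n \<in> {b..c}} \<inter> S) choose k"
  unfolding subsets_of_size_Int
  by (rule n_subsets) (rule finite_Int, simp only: finite_integers_in_interval simp_thms)

lemma finite_subsets_of_size: "finite (subsets_of_size b c k)"
  by (rule finite_subset[of _ "Pow {n. real_of_int n \<in> {b..c}}"])
    (use finite_integers_in_interval in \<open>auto simp: subsets_of_size_def\<close>)

lemma subsets_of_sizeD:
  assumes "A \<in> subsets_of_size b c k"
  shows "finite A" "card A = k" "a \<in> A \<Longrightarrow> b \<le> real_of_int a" "a \<in> A \<Longrightarrow> real_of_int a \<le> c"
  using assms finite_subset[OF _ finite_integers_in_interval]
  by (auto simp: subsets_of_size_def)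

text \<open>
  For a fixed shift \<open>t\<close>, the union of the \<open>A i\<close> lies in the sifted set exactly if each \<open>A i\<close> does,
  so the number of admissible tuples is a product of binomial coefficients.
\<close>

lemma sum_sieve_weight:
  fixes L :: "'i set" and b c :: "'i \<Rightarrow> real"
  assumes L: "finite L" and Q: "finite Q" "\<And>p. p \<in> Q \<Longrightarrow> prime p"
  shows "(\<Sum>A\<in>PiE L (\<lambda>i. subsets_of_size (b i) (c i) (k i)). sieve_weight r Q (\<Union>i\<in>L. A i)) =
    (\<Sum>t<\<Prod>Q. \<Prod>i\<in>L. real (card ({n. real_of_int n \<in> {b i..c i}} \<inter> sifted Q (int t)) choose k i))
      / (real (\<Prod>Q) * sieve_density Q ^ r)"
proof -
  let ?S = "\<lambda>i. subsets_of_size (b i) (c i) (k i)"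
  let ?Z = "real (\<Prod>Q) * sieve_density Q ^ r"
  have fin: "finite (PiE L ?S)" using L by (intro finite_PiE) (auto simp: finite_subsets_of_size)
  have "(\<Sum>A\<in>PiE L ?S. sieve_weight r Q (\<Union>i\<in>L. A i)) =
      (\<Sum>A\<in>PiE L ?S. (\<Sum>t<\<Prod>Q. if (\<Union>i\<in>L. A i) \<subseteq> sifted Q (int t) then 1 else 0) / ?Z)"
  proof (rule sum.cong)
    fix A assume "A \<in> PiE L ?S"
    then have fin_union: "finite (\<Union>i\<in>L. A i)"
      using L subsets_of_sizeD(1) by (auto dest: PiE_mem)
    show "sieve_weight r Q (\<Union>i\<in>L. A i) =
        (\<Sum>t<\<Prod>Q. if (\<Union>i\<in>L. A i) \<subseteq> sifted Q (int t) then 1 else 0) / ?Z"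
      by (rule sieve_weight_eq_average[OF Q fin_union])
  qed simp
  also have "\<dots> = (\<Sum>t<\<Prod>Q. \<Sum>A\<in>PiE L ?S. if (\<Union>i\<in>L. A i) \<subseteq> sifted Q (int t) then 1 else 0) / ?Z"
    unfolding sum_divide_distrib[symmetric] by (subst sum.swap) simp
  also have "(\<Sum>t<\<Prod>Q. \<Sum>A\<in>PiE L ?S. if (\<Union>i\<in>L. A i) \<subseteq> sifted Q (int t) then 1 else (0::real)) =
    (\<Sum>t<\<Prod>Q. \<Prod>i\<in>L. real (card ({n. real_of_int n \<in> {b i..c i}} \<inter> sifted Q (int t)) choose k i))"
  proof (rule sum.cong)
    fix t
    have "(\<Sum>A\<in>PiE L ?S. if (\<Union>i\<in>L. A i) \<subseteq> sifted Q (int t) then 1 else (0::real)) =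
        real (card {A \<in> PiE L ?S. (\<Union>i\<in>L. A i) \<subseteq> sifted Q (int t)})"
      using fin by (simp flip: sum.inter_filter)
    also have "{A \<in> PiE L ?S. (\<Union>i\<in>L. A i) \<subseteq> sifted Q (int t)} =
        PiE L (\<lambda>i. {B \<in> ?S i. B \<subseteq> sifted Q (int t)})"
      unfolding PiE_def Pi_def by blast
    finally show "(\<Sum>A\<in>PiE L ?S. if (\<Union>i\<in>L. A i) \<subseteq> sifted Q (int t) then 1 else (0::real)) =
        (\<Prod>i\<in>L. real (card ({n. real_of_int n \<in> {b i..c i}} \<inter> sifted Q (int t)) choose k i))"
      by (simp add: card_PiE[OF L] card_subsets_of_size_Int)
  qed simp
  finally show ?thesis .
qed

text \<open>
  Each of the \<open>\<Prod>Q\<close> summands in \<open>sum_sieve_weight\<close> is close to \<open>D^r M\<close>, where \<open>D\<close> is the density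
  of the sieve, and the denominator removes both factors.
\<close>

lemma sum_sieve_weight_bounds:
  fixes L :: "'i set" and b c :: "'i \<Rightarrow> real"
  assumes L: "finite L" and Q: "finite Q" "\<And>p. p \<in> Q \<Longrightarrow> prime p"
    and r: "r = (\<Sum>i\<in>L. k i)"
    and bc: "\<And>i. i \<in> L \<Longrightarrow> b i \<le> c i"
    and u: "\<And>i. i \<in> L \<Longrightarrow> real (\<Prod>Q) \<le> u * (c i - b i)" "0 \<le> u" "(1 + real r) * u \<le> 1"
  defines "M \<equiv> \<Prod>i\<in>L. (c i - b i) ^ k i / fact (k i)"
  defines "W \<equiv> \<Sum>A\<in>PiE L (\<lambda>i. subsets_of_size (b i) (c i) (k i)). sieve_weight r Q (\<Union>i\<in>L. A i)"
  shows "M * (1 - (1 + real r) * u) ^ r \<le> W" "W \<le> M * (1 + u) ^ r"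
proof -
  let ?D = "sieve_density Q" and ?P = "real (\<Prod>Q)"
  let ?f = "\<lambda>t. \<Prod>i\<in>L. real (card ({n. real_of_int n \<in> {b i..c i}} \<inter> sifted Q (int t)) choose k i)"
  have D: "?D > 0" using sieve_density_bounds[OF Q] by auto
  have P: "?P > 0" using Q prime_gt_0_nat by (auto intro!: prod_pos)
  have W: "W = (\<Sum>t<\<Prod>Q. ?f t) / (?P * ?D ^ r)"
    unfolding W_def by (rule sum_sieve_weight[OF L Q])
  have prod_eq: "(\<Prod>i\<in>L. (?D * (c i - b i)) ^ k i * x ^ k i / fact (k i)) = ?D ^ r * (M * x ^ r)" for x
    by (simp add: power_mult_distrib prod.distrib prod_dividef M_def r power_sum)
  have ki: "real (k i) \<le> real r" if "i \<in> L" for i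
    using member_le_sum[of i L k] L that by (simp add: r flip: of_nat_sum)
  have ku: "(1 + real (k i)) * u \<le> (1 + real r) * u" if "i \<in> L" for i
    using ki[OF that] u(2) by (intro mult_right_mono) auto
  have lower: "?D ^ r * (M * (1 - (1 + real r) * u) ^ r) \<le> ?f t" for t
    unfolding prod_eq[symmetric]
  proof (intro prod_mono conjI)
    fix i assume i: "i \<in> L"
    have "(?D * (c i - b i)) ^ k i * (1 - (1 + real r) * u) ^ k i
        \<le> (?D * (c i - b i)) ^ k i * (1 - (1 + real (k i)) * u) ^ k i"
      using D bc[OF i] ku[OF i] u(3) by (intro mult_left_mono power_mono) auto
    also have "\<dots> \<le> fact (k i) *
        real (card ({n. real_of_int n \<in> {b i..c i}} \<inter> sifted Q (int t)) choose k i)"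
      using ku[OF i] u(3) by (intro binomial_sifted_interval_bounds Q bc u(1) i) auto
    finally show "(?D * (c i - b i)) ^ k i * (1 - (1 + real r) * u) ^ k i / fact (k i)
        \<le> real (card ({n. real_of_int n \<in> {b i..c i}} \<inter> sifted Q (int t)) choose k i)"
      by (simp add: divide_le_eq mult.commute)
    show "0 \<le> (?D * (c i - b i)) ^ k i * (1 - (1 + real r) * u) ^ k i / fact (k i)"
      using D bc[OF i] u(3) by simp
  qed
  have upper: "?f t \<le> ?D ^ r * (M * (1 + u) ^ r)" for t
    unfolding prod_eq[symmetric]
  proof (intro prod_mono conjI)
    fix i assume i: "i \<in> L"
    have "fact (k i) * real (card ({n. real_of_int n \<in> {b i..c i}} \<inter> sifted Q (int t)) choose k i)
      \<le> (?D * (c i - b i)) ^ k i * (1 + u) ^ k i"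
      using ku[OF i] u(3) by (intro binomial_sifted_interval_bounds Q bc u(1) i) auto
    then show "real (card ({n. real_of_int n \<in> {b i..c i}} \<inter> sifted Q (int t)) choose k i)
        \<le> (?D * (c i - b i)) ^ k i * (1 + u) ^ k i / fact (k i)"
      by (simp add: le_divide_eq mult.commute)
  qed simp
  have Z: "?P * ?D ^ r > 0" using P D by simp
  have "?P * (?D ^ r * (M * (1 - (1 + real r) * u) ^ r)) \<le> (\<Sum>t<\<Prod>Q. ?f t)"
    using sum_bounded_below[of "{..<\<Prod>Q}" _ ?f, OF lower] by simp
  then show "M * (1 - (1 + real r) * u) ^ r \<le> W"
    unfolding W using Z by (simp add: le_divide_eq mult_ac)
  have "(\<Sum>t<\<Prod>Q. ?f t) \<le> ?P * (?D ^ r * (M * (1 + u) ^ r))"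
    using sum_bounded_above[of "{..<\<Prod>Q}" ?f, OF upper] by simp
  then show "W \<le> M * (1 + u) ^ r"
    unfolding W using Z by (simp add: divide_le_eq mult_ac)
qed

section \<open>Tuples with overlaps\<close>

lemma card_subsets_of_size_containing:
  assumes "real_of_int e \<in> {b..c}" "k \<ge> 1"
  shows "real (card {A \<in> subsets_of_size b c k. e \<in> A}) =
    real k / real (card {n::int. real_of_int n \<in> {b..c}}) * real (card (subsets_of_size b c k))"
proof -
  let ?I = "{n::int. real_of_int n \<in> {b..c}}"
  have I: "finite ?I" "e \<in> ?I" using finite_integers_in_interval assms(1) by auto
  have "bij_betw (insert e) {B. B \<subseteq> ?I - {e} \<and> card B = k - 1} {A \<in> subsets_of_size b c k. e \<in> A}"
  proof (rule bij_betw_byWitness[where f' = "\<lambda>A. A - {e}"])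
    show "insert e ` {B. B \<subseteq> ?I - {e} \<and> card B = k - 1} \<subseteq> {A \<in> subsets_of_size b c k. e \<in> A}"
    proof (intro image_subsetI)
      fix B assume B: "B \<in> {B. B \<subseteq> ?I - {e} \<and> card B = k - 1}"
      then have "finite B" using I(1) by (auto intro: finite_subset)
      moreover have "e \<notin> B" using B by blast
      ultimately have "card (insert e B) = k" using B assms(2) by simp
      then show "insert e B \<in> {A \<in> subsets_of_size b c k. e \<in> A}"
        using B I(2) by (auto simp: subsets_of_size_def)
    qed
    show "(\<lambda>A. A - {e}) ` {A \<in> subsets_of_size b c k. e \<in> A} \<subseteq> {B. B \<subseteq> ?I - {e} \<and> card B = k - 1}"
    proof (intro image_subsetI)
      fix A assume A: "A \<in> {A \<in> subsets_of_size b c k. e \<in> A}"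
      then have "finite A" "card A = k" using subsets_of_sizeD[of A b c k] by auto
      then show "A - {e} \<in> {B. B \<subseteq> ?I - {e} \<and> card B = k - 1}"
        using A by (auto simp: subsets_of_size_def)
    qed
  qed auto
  then have "card {A \<in> subsets_of_size b c k. e \<in> A} = card {B. B \<subseteq> ?I - {e} \<and> card B = k - 1}"
    by (rule bij_betw_same_card[symmetric])
  also have "\<dots> = (card ?I - 1) choose (k - 1)"
    using I by (subst n_subsets) auto
  finally have 1: "card {A \<in> subsets_of_size b c k. e \<in> A} = (card ?I - 1) choose (k - 1)" .
  have "card (subsets_of_size b c k) = card ?I choose k"
    unfolding subsets_of_size_def by (rule n_subsets[OF I(1)])
  then have "k * card (subsets_of_size b c k) = card ?I * card {A \<in> subsets_of_size b c k. e \<in> A}"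
    using times_binomial_minus1_eq[of k "card ?I"] assms(2) 1 by simp
  then have "real k * real (card (subsets_of_size b c k))
      = real (card ?I) * real (card {A \<in> subsets_of_size b c k. e \<in> A})"
    by (simp flip: of_nat_mult)
  moreover have "card ?I > 0" using I by (auto simp: card_gt_0_iff)
  ultimately show ?thesis by (simp add: field_simps)
qed

text \<open>
  A union bound over the pairs \<open>i \<noteq> j\<close> and the common elements \<open>e\<close>. A proportion \<open>k\<^sub>i/N\<^sub>i\<close> of the
  \<open>k\<^sub>i\<close>-subsets of an interval with \<open>N\<^sub>i\<close> integers contains \<open>e\<close>; since there are at most \<open>N\<^sub>i\<close> choices
  of \<open>e\<close>, a pair contributes the proportion \<open>k\<^sub>i k\<^sub>j / N\<^sub>j\<close>.
\<close>

lemma card_overlapping_tuples_le: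
  fixes L :: "'i set" and b c :: "'i \<Rightarrow> real"
  assumes L: "finite L" and k: "\<And>i. i \<in> L \<Longrightarrow> k i \<ge> 1" and r: "r = (\<Sum>i\<in>L. k i)"
    and n: "n > 0" "\<And>i. i \<in> L \<Longrightarrow> n \<le> real (card {n::int. real_of_int n \<in> {b i..c i}})"
  defines "S \<equiv> \<lambda>i. subsets_of_size (b i) (c i) (k i)"
  shows "real (card {A \<in> PiE L S. \<exists>i\<in>L. \<exists>j\<in>L. i \<noteq> j \<and> A i \<inter> A j \<noteq> {}})
    \<le> (real r)\<^sup>2 / n * real (card (PiE L S))"
proof -
  define I where "I i = {n::int. real_of_int n \<in> {b i..c i}}" for i
  define N where "N i = real (card (I i))" for i
  define F where "F i j e = {A \<in> PiE L S. e \<in> A i \<and> e \<in> A j}" for i j e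
  define Z where "Z = {(i, j). i \<in> L \<and> j \<in> L \<and> i \<noteq> j}"
  have finS: "finite (S i)" for i by (simp add: S_def finite_subsets_of_size)
  have finP: "finite (PiE L S)" using L finS by (intro finite_PiE) auto
  have finI: "finite (I i)" for i unfolding I_def by (rule finite_integers_in_interval)
  have Zsub: "Z \<subseteq> L \<times> L" by (auto simp: Z_def)
  then have finZ: "finite Z" using L finite_subset by blast
  have N: "N i \<ge> n" "N i > 0" if "i \<in> L" for i
    using n(1) n(2)[OF that] by (auto simp: N_def I_def)
  let ?C = "real (card (PiE L S))"
  have C: "?C = (\<Prod>m\<in>L. real (card (S m)))" by (simp add: card_PiE[OF L])
  have F: "real (card (F i j e)) = real (k i) / N i * (real (k j) / N j) * ?C"
    if "i \<in> L" "j \<in> L" "i \<noteq> j" "e \<in> I i" "e \<in> I j" for i j e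
  proof -
    let ?g = "\<lambda>m. if m = i \<or> m = j then {A \<in> S m. e \<in> A} else S m"
    have "F i j e = PiE L ?g"
      using that(1,2) by (auto simp: F_def PiE_def Pi_def)
    then have "real (card (F i j e)) = (\<Prod>m\<in>L. real (card (?g m)))" by (simp add: card_PiE[OF L])
    also have "\<dots> = (\<Prod>m\<in>L. (if m = i then real (k i) / N i else 1) *
        (if m = j then real (k j) / N j else 1) * real (card (S m)))"
    proof (rule prod.cong)
      fix m assume m: "m \<in> L"
      have "real (card {A \<in> S m. e \<in> A}) = real (k m) / N m * real (card (S m))" if "e \<in> I m"
        unfolding S_def N_def I_def using that k[OF m]
        by (intro card_subsets_of_size_containing) (auto simp: I_def)
      then show "real (card (?g m)) = (if m = i then real (k i) / N i else 1) *
          (if m = j then real (k j) / N j else 1) * real (card (S m))"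
        using that(3-5) by auto
    qed simp
    also have "\<dots> = real (k i) / N i * (real (k j) / N j) * ?C"
      using L that(1,2) by (simp add: prod.distrib C)
    finally show ?thesis .
  qed
  have "{A \<in> PiE L S. \<exists>i\<in>L. \<exists>j\<in>L. i \<noteq> j \<and> A i \<inter> A j \<noteq> {}}
      = (\<Union>z\<in>Z. \<Union>e\<in>I (fst z) \<inter> I (snd z). F (fst z) (snd z) e)"
  proof (intro equalityI subsetI)
    fix A assume "A \<in> {A \<in> PiE L S. \<exists>i\<in>L. \<exists>j\<in>L. i \<noteq> j \<and> A i \<inter> A j \<noteq> {}}"
    then obtain i j e where *: "A \<in> PiE L S" "i \<in> L" "j \<in> L" "i \<noteq> j" "e \<in> A i" "e \<in> A j" by blast
    then have "e \<in> I i" "e \<in> I j"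
      using PiE_mem[OF *(1)] by (auto simp: S_def I_def subsets_of_size_def)
    then show "A \<in> (\<Union>z\<in>Z. \<Union>e\<in>I (fst z) \<inter> I (snd z). F (fst z) (snd z) e)"
      using * by (auto simp: Z_def F_def intro!: bexI[of _ "(i, j)"])
  qed (auto simp: Z_def F_def)
  also have "card \<dots> \<le> (\<Sum>z\<in>Z. card (\<Union>e\<in>I (fst z) \<inter> I (snd z). F (fst z) (snd z) e))"
    by (rule card_UN_le[OF finZ])
  also have "\<dots> \<le> (\<Sum>z\<in>Z. \<Sum>e\<in>I (fst z) \<inter> I (snd z). card (F (fst z) (snd z) e))"
    using finI by (intro sum_mono card_UN_le) blast
  finally have "real (card {A \<in> PiE L S. \<exists>i\<in>L. \<exists>j\<in>L. i \<noteq> j \<and> A i \<inter> A j \<noteq> {}})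
      \<le> (\<Sum>z\<in>Z. \<Sum>e\<in>I (fst z) \<inter> I (snd z). real (card (F (fst z) (snd z) e)))"
    by (simp flip: of_nat_sum)
  also have "\<dots> \<le> (\<Sum>z\<in>Z. real (k (fst z)) * real (k (snd z)) / n * ?C)"
  proof (rule sum_mono)
    fix z assume "z \<in> Z"
    then obtain i j where z: "z = (i, j)" "i \<in> L" "j \<in> L" "i \<noteq> j" by (auto simp: Z_def)
    have "(\<Sum>e\<in>I i \<inter> I j. real (card (F i j e))) = 
        real (card (I i \<inter> I j)) * (real (k i) / N i * (real (k j) / N j) * ?C)"
      using F[OF z(2-4)] by simp
    also have "\<dots> \<le> N i * (real (k i) / N i * (real (k j) / N j) * ?C)"
      using N(2) z finI by (intro mult_right_mono) (auto simp: N_def intro!: card_mono)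
    also have "\<dots> = real (k i) * real (k j) / N j * ?C" using N(2)[OF z(2)] by simp
    also have "\<dots> \<le> real (k i) * real (k j) / n * ?C"
      using N[OF z(3)] n(1) by (intro mult_right_mono divide_left_mono) auto
    finally show "(\<Sum>e\<in>I (fst z) \<inter> I (snd z). real (card (F (fst z) (snd z) e)))
        \<le> real (k (fst z)) * real (k (snd z)) / n * ?C" by (simp add: z(1))
  qed
  also have "\<dots> \<le> (\<Sum>z\<in>L \<times> L. real (k (fst z)) * real (k (snd z)) / n * ?C)"
    using L Zsub n(1) by (intro sum_mono2) auto
  also have "\<dots> = (\<Sum>i\<in>L. \<Sum>j\<in>L. real (k i) * real (k j) / n * ?C)"
    by (simp add: sum.cartesian_product case_prod_unfold)
  also have "\<dots> = (real r)\<^sup>2 / n * ?C"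
    
    by (simp only: r of_nat_sum power2_eq_square sum_product)
      (simp only: sum_divide_distrib sum_distrib_right)
  finally show ?thesis .
qed

section \<open>An estimate with explicit error\<close>

text \<open>
  The truncated Euler product of \<open>H\<close> equals the sieve weight if \<open>H\<close> has exactly \<open>r\<close> elements, and it
  is at most the sieve weight otherwise, because then too few factors \<open>(1 - 1/p)^(-1)\<close> are present.
\<close>

lemma singular_series_near_sieve_weight:
  assumes H: "finite H" "card H \<le> r" and y: "y > 1" "r \<le> y"
    and X: "X \<ge> 1" "\<And>a b. a \<in> H \<Longrightarrow> b \<in> H \<Longrightarrow> \<bar>real_of_int (a - b)\<bar> \<le> X"
    and \<eta>: "(real r)\<^sup>2 / y \<le> \<eta>" "exp (real r ^ 3 * ln X / (y * ln y)) \<le> 1 + \<eta>" "\<eta> \<le> 1"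
  defines "W \<equiv> sieve_weight r (primes_upto y) H"
  shows "card H = r \<Longrightarrow> \<bar>singular_series H - W\<bar> \<le> \<eta> * W"
    and "\<bar>singular_series H - W\<bar> \<le> W"
proof -
  let ?T = "sieve_weight (card H) (primes_upto y) H"
  have T: "0 \<le> ?T" "?T \<le> W" unfolding W_def
    using sieve_weight_bounds(1)[OF H(1)] sieve_weight_mono[OF H] by auto
  have "(1 - \<eta>) * ?T \<le> (1 - (real r)\<^sup>2 / y) * ?T"
    using \<eta>(1) T(1) by (intro mult_right_mono) auto
  also have "\<dots> \<le> singular_series H"
    using singular_series_bounds(1)[OF H y X] by (simp add: euler_product_eq_sieve_weight)
  finally have lower: "(1 - \<eta>) * ?T \<le> singular_series H" .
  have "singular_series H \<le> exp (real r ^ 3 * ln X / (y * ln y)) * ?T"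
    using singular_series_bounds(2)[OF H y X] by (simp add: euler_product_eq_sieve_weight)
  also have "\<dots> \<le> (1 + \<eta>) * ?T" using \<eta>(2) T(1) by (intro mult_right_mono) auto
  finally have upper: "singular_series H \<le> (1 + \<eta>) * ?T" .
  show "\<bar>singular_series H - W\<bar> \<le> \<eta> * W" if "card H = r"
  proof -
    have "?T = W" unfolding W_def that ..
    with lower upper have "W - \<eta> * W \<le> singular_series H" "singular_series H \<le> W + \<eta> * W"
      by (simp_all only: left_diff_distrib distrib_right mult_1)
    then show ?thesis by linarith
  qed
  have "0 \<le> (1 - \<eta>) * ?T" using \<eta>(3) T(1) by simp
  moreover have "(1 + \<eta>) * ?T \<le> 2 * ?T" using \<eta>(3) T(1) by (intro mult_right_mono) auto
  ultimately show "\<bar>singular_series H - W\<bar> \<le> W"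
    using lower upper T(2) unfolding abs_le_iff by linarith
qed

lemma power_one_plus_le:
  fixes u :: real
  assumes "0 \<le> u" "u \<le> 1"
  shows "(1 + u) ^ r \<le> 1 + (2 ^ r - 1) * u"
proof (induction r)
  case (Suc r)
  let ?x = "(2 ^ r - 1 :: real)"
  have x: "?x \<ge> 0" by simp
  have "(1 + u) ^ Suc r \<le> (1 + u) * (1 + ?x * u)"
    using Suc.IH assms by (simp add: mult_left_mono)
  also have "\<dots> = 1 + (1 + ?x) * u + ?x * u * u" by (simp add: algebra_simps)
  also have "?x * u * u \<le> ?x * u * 1" using assms x by (intro mult_left_mono) auto
  also have "1 + (1 + ?x) * u + ?x * u * 1 = 1 + (2 ^ Suc r - 1) * u" by (simp add: algebra_simps)
  finally show ?case by simp
qed simp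

lemma two_power_ge_Suc: "(1::real) + real r \<le> 2 ^ r"
proof -
  have "Suc r \<le> 2 ^ r" by (simp add: Suc_le_eq)
  then have "real (Suc r) \<le> real (2 ^ r)" by (simp only: of_nat_le_iff)
  then show ?thesis by simp
qed

text \<open>
  Three errors are added up: \<open>\<eta>\<close> for the primes above \<open>y\<close>, multiples of \<open>u\<close> for the incomplete
  periods at the ends of the intervals, and \<open>y^r u\<close> for the tuples with overlaps, whose proportion
  is \<open>O(u)\<close> and whose weights are at most \<open>y^r\<close>.
\<close>

lemma sum_singular_series_estimate:
  fixes L :: "'i set" and b c :: "'i \<Rightarrow> real" and k :: "'i \<Rightarrow> nat"
  assumes L: "finite L" and k: "\<And>i. i \<in> L \<Longrightarrow> k i \<ge> 1"
    and r: "r = (\<Sum>i\<in>L. k i)" "r \<ge> 1"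
    and bc: "\<And>i. i \<in> L \<Longrightarrow> 0 \<le> b i \<and> b i \<le> c i \<and> c i \<le> X" "X \<ge> 1"
    and y: "y > 1" "r \<le> y"
    and \<eta>: "(real r)\<^sup>2 / y \<le> \<eta>" "exp (real r ^ 3 * ln X / (y * ln y)) \<le> 1 + \<eta>" "\<eta> \<le> 1"
    and u: "\<And>i. i \<in> L \<Longrightarrow> real (\<Prod>(primes_upto y)) \<le> u * (c i - b i)" "u > 0" "2 ^ r * u \<le> 1"
  defines "M \<equiv> \<Prod>i\<in>L. (c i - b i) ^ k i / fact (k i)"
  shows "M > 0"
    and "\<bar>(\<Sum>A\<in>PiE L (\<lambda>i. subsets_of_size (b i) (c i) (k i)). singular_series (\<Union>i\<in>L. A i)) - M\<bar>
      \<le> M * (2 * \<eta> + (2 ^ r + real r * (1 + real r) + 4 * (real r)\<^sup>2) * (real y ^ r * u))"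
proof -
  define S where "S i = subsets_of_size (b i) (c i) (k i)" for i
  define Q where "Q = primes_upto y"
  define W where "W A = sieve_weight r Q (\<Union>i\<in>L. A i)" for A :: "'i \<Rightarrow> int set"
  define G where "G A = singular_series (\<Union>i\<in>L. A i)" for A :: "'i \<Rightarrow> int set"
  define Bad where "Bad = {A \<in> PiE L S. \<exists>i\<in>L. \<exists>j\<in>L. i \<noteq> j \<and> A i \<inter> A j \<noteq> {}}"
  have Q: "finite Q" "\<And>p. p \<in> Q \<Longrightarrow> prime p" by (simp_all add: Q_def primes_uptoD)
  have finP: "finite (PiE L S)"
    using L by (intro finite_PiE) (auto simp: S_def finite_subsets_of_size)
  have P: "\<Prod>Q \<ge> 1" using Q prime_gt_0_nat by (auto simp: Suc_le_eq intro!: prod_pos)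
  have d: "1 \<le> u * (c i - b i)" if "i \<in> L" for i
    using u(1)[OF that] P unfolding Q_def[symmetric] by linarith
  have d0: "c i - b i > 0" if "i \<in> L" for i
    using d[OF that] u(2) zero_less_mult_pos[of u "c i - b i"] by linarith
  show M0: "M > 0" unfolding M_def using d0 by (intro prod_pos) simp
  have r2: "1 + real r \<le> 2 ^ r" by (rule two_power_ge_Suc)
  have ru: "(1 + real r) * u \<le> 1"
    using mult_right_mono[OF r2, of u] u(2,3) by linarith
  have "2 * u \<le> (1 + real r) * u" using r(2) u(2) by (intro mult_right_mono) auto
  then have u2: "u \<le> 1 / 2" using ru by linarith
  have up: "(1 + u) ^ r \<le> 1 + (2 ^ r - 1) * u"
    using u2 u(2) by (intro power_one_plus_le) auto
  also have "\<dots> \<le> 2" using u(2,3) by (simp add: left_diff_distrib)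
  finally have up2: "(1 + u) ^ r \<le> 2" .

  have W_upper: "(\<Sum>A\<in>PiE L S. W A) \<le> M * (1 + u) ^ r"
    and W_lower: "M * (1 - (1 + real r) * u) ^ r \<le> (\<Sum>A\<in>PiE L S. W A)"
    unfolding M_def W_def S_def
    using bc(1) u(1,2) ru by (intro sum_sieve_weight_bounds L Q r; simp add: Q_def)+
  have lower: "1 - real r * (1 + real r) * u \<le> (1 - (1 + real r) * u) ^ r"
    using Bernoulli_inequality[of "- (1 + real r) * u" r] ru by (simp add: algebra_simps)
  have "M * (1 - real r * (1 + real r) * u) \<le> (\<Sum>A\<in>PiE L S. W A)"
    using mult_left_mono[OF lower, of M] M0 W_lower by linarith
  moreover have "(\<Sum>A\<in>PiE L S. W A) \<le> M * (1 + (2 ^ r - 1) * u)"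
    using mult_left_mono[OF up, of M] M0 W_upper by linarith
  moreover have "0 \<le> M * u * (2 ^ r - 1)" "0 \<le> M * u * (real r * (1 + real r))" "0 \<le> M * u"
    using M0 u(2) by simp_all
  ultimately have WM: "\<bar>(\<Sum>A\<in>PiE L S. W A) - M\<bar> \<le> M * ((2 ^ r + real r * (1 + real r)) * u)"
    unfolding abs_le_iff by (simp add: algebra_simps)
  have W2: "(\<Sum>A\<in>PiE L S. W A) \<le> 2 * M"
    using W_upper mult_left_mono[OF up2, of M] M0 by linarith

  \<comment> \<open>With the empty sieve every tuple has weight 1, so the same bounds count all tuples.\<close>
  have no_sieve: "sieve_weight r {} H = 1" for H
    by (simp add: sieve_weight_def sieve_density_def)
  have "(\<Sum>A\<in>PiE L S. sieve_weight r {} (\<Union>i\<in>L. A i)) \<le> M * (1 + u) ^ r"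
    unfolding M_def S_def
    using bc(1) u(2) ru d by (intro sum_sieve_weight_bounds L r) auto
  then have "real (card (PiE L S)) \<le> M * (1 + u) ^ r" by (simp add: no_sieve)
  then have card_P: "real (card (PiE L S)) \<le> 2 * M"
    using mult_left_mono[OF up2, of M] M0 by linarith
  have n: "1 / (2 * u) \<le> real (card {n::int. real_of_int n \<in> {b i..c i}})" if "i \<in> L" for i
  proof -
    have "\<bar>real (card {n::int. real_of_int n \<in> {b i..c i}}) - (c i - b i)\<bar> \<le> 1"
      using card_sifted_interval[of "{}" "b i" "c i" 0] bc(1)[OF that] by (simp add: sifted_def)
    moreover have "1 / u \<le> c i - b i" using d[OF that] u(2) by (simp add: divide_le_eq mult.commute)
    moreover have "1 / u = 1 / (2 * u) + 1 / (2 * u)" "1 \<le> 1 / (2 * u)"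
      using u(2) u2 by (simp_all add: field_simps)
    ultimately show ?thesis by linarith
  qed
  have "real (card Bad) \<le> (real r)\<^sup>2 / (1 / (2 * u)) * real (card (PiE L S))"
    unfolding Bad_def S_def using u(2) n by (intro card_overlapping_tuples_le L k r(1)) auto
  also have "\<dots> \<le> (real r)\<^sup>2 / (1 / (2 * u)) * (2 * M)"
    using card_P u(2) by (intro mult_left_mono) auto
  finally have Bad: "real (card Bad) \<le> M * (4 * (real r)\<^sup>2 * u)" by (simp add: mult_ac)

  have \<eta>0: "\<eta> \<ge> 0" using \<eta>(1) by (rule order.trans[rotated]) simp
  have GW: "\<bar>G A - W A\<bar> \<le> \<eta> * W A + (if A \<in> Bad then real y ^ r else 0)"
    if A: "A \<in> PiE L S" for A
  proof -
    let ?H = "\<Union>i\<in>L. A i"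
    have Ai: "finite (A i)" "card (A i) = k i" "\<And>a. a \<in> A i \<Longrightarrow> 0 \<le> real_of_int a \<and> real_of_int a \<le> X"
      if "i \<in> L" for i
      using subsets_of_sizeD[of "A i" "b i" "c i" "k i"] PiE_mem[OF A that] bc(1)[OF that]
      by (force simp: S_def)+
    have H: "finite ?H" using L Ai(1) by blast
    have cardH: "card ?H \<le> r"
      unfolding r(1) using card_UN_le[OF L, of A] Ai(2) by simp
    have diff: "\<bar>real_of_int (a - a')\<bar> \<le> X" if "a \<in> ?H" "a' \<in> ?H" for a a'
    proof -
      have "0 \<le> real_of_int a \<and> real_of_int a \<le> X" "0 \<le> real_of_int a' \<and> real_of_int a' \<le> X"
        using that Ai(3) by blast+
      then show ?thesis unfolding of_int_diff abs_le_iff by linarith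
    qed
    note near = singular_series_near_sieve_weight[OF H cardH y bc(2) diff \<eta>]
    have W: "0 \<le> W A" "W A \<le> real y ^ r"
      unfolding W_def Q_def using sieve_weight_bounds[OF H] y(1) by auto
    show ?thesis
    proof (cases "A \<in> Bad")
      case True
      have "\<bar>G A - W A\<bar> \<le> W A" unfolding G_def W_def Q_def by (rule near(2))
      moreover have "0 \<le> \<eta> * W A" using W \<eta>0 by simp
      ultimately show ?thesis using True W by simp
    next
      case False
      then have "\<forall>i\<in>L. \<forall>j\<in>L. i \<noteq> j \<longrightarrow> A i \<inter> A j = {}" using A by (auto simp: Bad_def)
      then have card_eq: "card ?H = r" using L Ai(1,2) by (simp add: card_UN_disjoint r(1))
      have "\<bar>G A - W A\<bar> \<le> \<eta> * W A"
        unfolding G_def W_def Q_def by (rule near(1)) (simp_all only: card_eq)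
      then show ?thesis using False by simp
    qed
  qed
  have "\<bar>(\<Sum>A\<in>PiE L S. G A) - (\<Sum>A\<in>PiE L S. W A)\<bar> \<le> (\<Sum>A\<in>PiE L S. \<bar>G A - W A\<bar>)"
    unfolding sum_subtractf[symmetric] by (rule sum_abs)
  also have "\<dots> \<le> (\<Sum>A\<in>PiE L S. \<eta> * W A + (if A \<in> Bad then real y ^ r else 0))"
    by (rule sum_mono[OF GW])
  also have "\<dots> = \<eta> * (\<Sum>A\<in>PiE L S. W A) + real (card Bad) * real y ^ r"
  proof -
    have "PiE L S \<inter> Bad = Bad" by (auto simp: Bad_def)
    then show ?thesis using finP by (simp add: sum.distrib sum_distrib_left sum.If_cases)
  qed
  also have "\<dots> \<le> \<eta> * (2 * M) + M * (4 * (real r)\<^sup>2 * u) * real y ^ r"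
    using W2 Bad \<eta>0 by (intro add_mono mult_left_mono mult_right_mono) auto
  finally have "\<bar>(\<Sum>A\<in>PiE L S. G A) - M\<bar>
      \<le> \<eta> * (2 * M) + M * (4 * (real r)\<^sup>2 * u) * real y ^ r + M * ((2 ^ r + real r * (1 + real r)) * u)"
    using WM by linarith
  also have "M * ((2 ^ r + real r * (1 + real r)) * u) \<le> M * ((2 ^ r + real r * (1 + real r)) * (real y ^ r * u))"
  proof -
    have "1 \<le> real y ^ r" using y(1) by (intro one_le_power) simp
    then have "1 * u \<le> real y ^ r * u" using u(2) by (intro mult_right_mono) auto
    then show ?thesis using M0 by (intro mult_left_mono) simp_all
  qed
  also have "\<eta> * (2 * M) + M * (4 * (real r)\<^sup>2 * u) * real y ^ r
      + M * ((2 ^ r + real r * (1 + real r)) * (real y ^ r * u))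
      = M * (2 * \<eta> + (2 ^ r + real r * (1 + real r) + 4 * (real r)\<^sup>2) * (real y ^ r * u))"
    by (simp add: algebra_simps)
  finally show "\<bar>(\<Sum>A\<in>PiE L (\<lambda>i. subsets_of_size (b i) (c i) (k i)). singular_series (\<Union>i\<in>L. A i)) - M\<bar>
      \<le> M * (2 * \<eta> + (2 ^ r + real r * (1 + real r) + 4 * (real r)\<^sup>2) * (real y ^ r * u))"
    by (simp add: G_def S_def[abs_def])
qed

section \<open>The choice of the sifting range\<close>

lemma four_power_floor_le:
  fixes c h :: real
  assumes "h \<ge> 1" "c \<ge> 0"
  shows "4 ^ nat \<lfloor>c * ln h\<rfloor> \<le> h powr (2 * c)"
proof -
  have "ln 4 \<le> (2::real)"
  proof -
    have "(4::real) \<le> exp 1 * exp 1"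
      using mult_mono[of 2 "exp 1" 2 "exp (1::real)"] exp_ge_add_one_self[of 1] by simp
    also have "\<dots> = exp 2" by (simp flip: exp_add)
    finally have "ln 4 \<le> ln (exp (2::real))" by (subst ln_le_cancel_iff) auto
    then show ?thesis by simp
  qed
  have y: "real (nat \<lfloor>c * ln h\<rfloor>) \<le> c * ln h" using assms by simp
  have "(4::real) ^ nat \<lfloor>c * ln h\<rfloor> = exp (real (nat \<lfloor>c * ln h\<rfloor>) * ln 4)"
    by (simp add: exp_of_nat_mult)
  also have "\<dots> \<le> exp (c * ln h * 2)"
    using y \<open>ln 4 \<le> 2\<close> assms by (intro exp_le_cancel_iff[THEN iffD2] mult_mono) auto
  also have "\<dots> = h powr (2 * c)" using assms by (simp add: powr_def mult_ac)
  finally show ?thesis .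
qed

text \<open>
  The exponent \<open>r\<^sup>3 ln h / (y ln y)\<close> is at most \<open>4 r\<^sup>3 / (c ln (ln h))\<close>, because \<open>y \<ge> (c/2) ln h\<close> and
  \<open>ln y \<ge> ln (ln h) / 2\<close>. As \<open>exp x \<le> 1 + 2 x\<close> on \<open>[0,1]\<close>, twice that value is
  admissible for \<open>\<eta>\<close>; it also exceeds \<open>r\<^sup>2/y\<close>, which is \<open>O(1/log h)\<close>. The quantities with the
  factor \<open>u\<close>, a negative power of \<open>h\<close>, are smaller than any power of \<open>1/log h\<close>.
\<close>

lemma eventually_sieve_parameters:
  fixes r :: nat and c A :: real
  assumes c: "c > 0" and r: "r \<ge> 1"
  defines "C \<equiv> 8 * real r ^ 3 / c"
  shows "\<forall>\<^sub>F h in at_top.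
    let y = nat \<lfloor>c * ln h\<rfloor>; \<eta> = C / ln (ln h); u = h powr (- (2 * c)) in
      1 \<le> h \<and> 0 < ln (ln h) \<and> 1 < y \<and> r \<le> y \<and> (real r)\<^sup>2 / real y \<le> \<eta> \<and>
      exp (real r ^ 3 * ln h / (real y * ln (real y))) \<le> 1 + \<eta> \<and> \<eta> \<le> 1 \<and>
      2 ^ r * u \<le> 1 \<and> A * (real y ^ r * u) \<le> 1 / ln (ln h)"
proof -
  have 1: "\<forall>\<^sub>F h::real in at_top. h \<ge> 3" by (rule eventually_ge_at_top)
  have 2: "\<forall>\<^sub>F h::real in at_top. c * ln h \<ge> real r + 3" using c by real_asymp
  have 3: "\<forall>\<^sub>F h::real in at_top. ln (c / 2 * ln h) \<ge> ln (ln h) / 2" using c by real_asymp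
  have 4: "\<forall>\<^sub>F h::real in at_top. ln (ln h) \<ge> C" by real_asymp
  have 5: "\<forall>\<^sub>F h::real in at_top. ln h \<ge> ln (ln h)" by real_asymp
  have 6: "\<forall>\<^sub>F h::real in at_top. 2 ^ r * h powr (- (2 * c)) \<le> 1" using c by real_asymp
  have 7: "\<forall>\<^sub>F h::real in at_top. \<bar>A\<bar> * ((c * ln h) ^ r * h powr (- (2 * c))) \<le> 1 / ln (ln h)"
    using c r by real_asymp
  have C0: "C > 0" using c r by (simp add: C_def)
  show ?thesis
    using 1 2 3 4 5 6 7
  proof eventually_elim
    case (elim h)
    define y where "y = nat \<lfloor>c * ln h\<rfloor>"
    define L where "L = ln (ln h)"
    have L: "L > 0" "L \<ge> C" using elim(4) C0 by (simp_all add: L_def)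
    have y_real: "real y \<le> c * ln h" "real y \<ge> c * ln h - 1"
      using elim(2) unfolding y_def by linarith+
    then have y: "1 < y" "r \<le> y" using elim(2) by linarith+
    have y_half: "real y \<ge> c / 2 * ln h" using y_real elim(2) by linarith
    have lnh: "ln h > 0" using elim(1) by simp
    have half0: "c / 2 * ln h > 0" using c lnh by simp
    have "ln (c / 2 * ln h) \<le> ln (real y)" using y_half half0 by (subst ln_le_cancel_iff) auto
    then have lny: "ln (real y) \<ge> L / 2" using elim(3) by (simp add: L_def)
    have "real r ^ 2 \<le> real r ^ 3" using r by (intro power_increasing) auto
    moreover have "0 \<le> real r ^ 3" by simp
    ultimately have r3: "(real r)\<^sup>2 \<le> 4 * real r ^ 3" by linarith
    have "(real r)\<^sup>2 / real y \<le> (real r)\<^sup>2 / (c / 2 * ln h)"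
      using y_half half0 c lnh y by (intro divide_left_mono mult_pos_pos) auto
    also have "\<dots> \<le> (real r)\<^sup>2 / (c / 2 * L)"
      using elim(5) L c half0 by (intro divide_left_mono mult_left_mono mult_pos_pos) (auto simp: L_def)
    also have "\<dots> \<le> (4 * real r ^ 3) / (c / 2 * L)"
      using r3 L c by (intro divide_right_mono) auto
    also have "\<dots> = C / L" by (simp add: C_def)
    finally have eta1: "(real r)\<^sup>2 / real y \<le> C / L" .
    define x where "x = real r ^ 3 * ln h / (real y * ln (real y))"
    define q where "q = C / L"
    have "x \<le> real r ^ 3 * ln h / ((c / 2 * ln h) * (L / 2))"
      unfolding x_def
      using y_half lny half0 L lnh y c by (intro divide_left_mono mult_mono mult_pos_pos) auto
    also have "\<dots> = q / 2" using lnh by (simp add: C_def q_def mult.commute)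
    finally have x: "x \<le> q / 2" .
    have x0: "0 \<le> x" using lnh y by (simp add: x_def)
    have q: "q \<le> 1" using L by (simp add: q_def)
    have "exp x \<le> 1 + x + x\<^sup>2" using x x0 q by (intro exp_bound) auto
    moreover have "x\<^sup>2 \<le> x"
      using x x0 q mult_left_le[of x x] by (simp add: power2_eq_square)
    ultimately have "exp x \<le> 1 + q" using x by linarith
    then have eta2: "C / L \<le> 1" and eta3: "exp (real r ^ 3 * ln h / (real y * ln (real y))) \<le> 1 + C / L"
      using q by (simp_all only: q_def x_def)
    have "A * (real y ^ r * h powr (- (2 * c))) \<le> \<bar>A\<bar> * (real y ^ r * h powr (- (2 * c)))"
      by (intro mult_right_mono) auto
    also have "\<dots> \<le> \<bar>A\<bar> * ((c * ln h) ^ r * h powr (- (2 * c)))"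
      using y_real by (intro mult_left_mono mult_right_mono power_mono) auto
    also have "\<dots> \<le> 1 / L" using elim(7) by (simp add: L_def)
    finally show ?case
      unfolding Let_def y_def[symmetric] L_def[symmetric]
      using elim(1,6) L y eta1 eta2 eta3 by auto
  qed
qed

theorem theorem2:
  fixes r :: nat and \<delta> :: real
  assumes "0 < \<delta>" and "\<delta> < 1"
  shows "\<exists>K>0. \<forall>(l::nat) (k :: nat \<Rightarrow> nat) (B :: nat \<Rightarrow> real \<Rightarrow> real) (C :: nat \<Rightarrow> real \<Rightarrow> real).
    l \<ge> 1 \<longrightarrow> (\<forall>i\<in>{1..l}. k i \<ge> 1) \<longrightarrow> r = (\<Sum>i=1..l. k i) \<longrightarrow>
    (\<forall>i\<in>{1..l}. \<forall>h>0. B i h \<le> C i h \<and> {B i h..C i h} \<subseteq> {0..h}) \<longrightarrow>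
    (\<forall>i\<in>{1..l}. (\<lambda>h. h powr \<delta>) \<in> o[at_top](\<lambda>h. C i h - B i h)) \<longrightarrow>
    (\<exists>E :: real \<Rightarrow> real. \<forall>\<^sub>F h in at_top.
       (\<Sum>A \<in> PiE {1..l} (\<lambda>i. subsets_of_size (B i h) (C i h) (k i)).
          singular_series (\<Union>i\<in>{1..l}. A i))
         = (\<Prod>i=1..l. (C i h - B i h) ^ k i / fact (k i)) * (1 + E h)
       \<and> \<bar>E h\<bar> \<le> K * (1 / ln (ln h)))"
proof -
  define c where "c = \<delta> / 4"
  define C0 where "C0 = 8 * real r ^ 3 / c"
  define R where "R = 2 ^ r + real r * (1 + real r) + 4 * (real r)\<^sup>2"
  have c: "c > 0" using assms by (simp add: c_def)
  have K: "2 * C0 + 1 > 0" using c by (simp add: C0_def add_nonneg_pos)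
  show ?thesis
  proof (rule exI[of _ "2 * C0 + 1"], intro conjI[OF K] allI impI)
    fix l :: nat and k :: "nat \<Rightarrow> nat" and B C :: "nat \<Rightarrow> real \<Rightarrow> real"
    assume l: "l \<ge> 1" and k: "\<forall>i\<in>{1..l}. k i \<ge> 1" and r: "r = (\<Sum>i=1..l. k i)"
      and BC: "\<forall>i\<in>{1..l}. \<forall>h>0. B i h \<le> C i h \<and> {B i h..C i h} \<subseteq> {0..h}"
      and o: "\<forall>i\<in>{1..l}. (\<lambda>h. h powr \<delta>) \<in> o[at_top](\<lambda>h. C i h - B i h)"
    define M where "M h = (\<Prod>i=1..l. (C i h - B i h) ^ k i / fact (k i))" for h
    define S where "S h = (\<Sum>A \<in> PiE {1..l} (\<lambda>i. subsets_of_size (B i h) (C i h) (k i)).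
      singular_series (\<Union>i\<in>{1..l}. A i))" for h
    have r1: "r \<ge> 1"
      using l k member_le_sum[of 1 "{1..l}" k] by (force simp: r)
    have "\<forall>\<^sub>F h in at_top. \<forall>i\<in>{1..l}. norm (h powr \<delta>) \<le> 1 * norm (C i h - B i h)"
      using o by (intro eventually_ball_finite ballI landau_o.smallD) auto
    then have estimate: "\<forall>\<^sub>F h in at_top. S h = M h * (1 + (S h / M h - 1)) \<and>
        \<bar>S h / M h - 1\<bar> \<le> (2 * C0 + 1) * (1 / ln (ln h))"
      using eventually_sieve_parameters[OF c r1, of R]
    proof eventually_elim
      case (elim h)
      define y where "y = nat \<lfloor>c * ln h\<rfloor>"
      define \<eta> where "\<eta> = C0 / ln (ln h)"
      define u where "u = h powr (- (2 * c))"
      have h: "1 \<le> h" and y: "1 < y" "r \<le> y"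
        and \<eta>: "(real r)\<^sup>2 / real y \<le> \<eta>"
          "exp (real r ^ 3 * ln h / (real y * ln (real y))) \<le> 1 + \<eta>" "\<eta> \<le> 1"
        and u: "2 ^ r * u \<le> 1" "R * (real y ^ r * u) \<le> 1 / ln (ln h)"
        using elim(2) unfolding Let_def y_def[symmetric] C0_def[symmetric] \<eta>_def[symmetric]
          u_def[symmetric] by blast+
      have u0: "u > 0" using h by (simp add: u_def)
      have bc: "0 \<le> B i h \<and> B i h \<le> C i h \<and> C i h \<le> h" if "i \<in> {1..l}" for i
        using BC[rule_format, OF that, of h] h by auto
      have "real (\<Prod>(primes_upto y)) \<le> u * (C i h - B i h)" if "i \<in> {1..l}" for i
      proof -
        have "real (\<Prod>(primes_upto y)) \<le> real (4 ^ y)"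
          unfolding primes_upto_def by (simp only: of_nat_le_iff primorial_le)
        also have "\<dots> = 4 ^ y" by simp
        also have "\<dots> \<le> h powr (2 * c)"
          unfolding y_def using h c by (intro four_power_floor_le) auto
        \<comment> \<open>This step uses \<open>4 c = \<delta>\<close>.\<close>
        also have "\<dots> = u * h powr \<delta>"
          by (simp add: u_def c_def flip: powr_add)
        also have "\<dots> \<le> u * (C i h - B i h)"
          using elim(1)[rule_format, OF that] bc[OF that] u0 by (intro mult_left_mono) auto
        finally show ?thesis .
      qed
      note bound = sum_singular_series_estimate[of "{1..l}" k r "\<lambda>i. B i h" "\<lambda>i. C i h" h y \<eta> u,
          OF finite_atLeastAtMost _ r r1 bc h y \<eta> this u0 u(1)]
      have M: "M h > 0" unfolding M_def using k by (intro bound(1)) auto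
      have "\<bar>S h - M h\<bar> \<le> M h * (2 * \<eta> + R * (real y ^ r * u))"
        unfolding M_def S_def R_def using k by (intro bound(2)) auto
      also have "\<dots> \<le> M h * (2 * \<eta> + 1 / ln (ln h))"
        using M u(2) by (intro mult_left_mono add_left_mono) auto
      also have "2 * \<eta> + 1 / ln (ln h) = (2 * C0 + 1) * (1 / ln (ln h))"
        by (simp add: \<eta>_def add_divide_distrib)
      finally have quotient: "\<bar>S h - M h\<bar> / M h \<le> (2 * C0 + 1) * (1 / ln (ln h))"
        using M by (simp add: divide_le_eq mult.commute)
      have "S h / M h - 1 = (S h - M h) / M h" using M by (simp add: diff_divide_distrib)
      then have "\<bar>S h / M h - 1\<bar> = \<bar>S h - M h\<bar> / M h" using M by (simp only: abs_divide abs_of_pos)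
      then have error: "\<bar>S h / M h - 1\<bar> \<le> (2 * C0 + 1) * (1 / ln (ln h))"
        using quotient by (rule ord_eq_le_trans)
      have "S h = M h * (1 + (S h / M h - 1))" using M by simp
      then show ?case using error by (rule conjI)
    qed
    show "\<exists>E :: real \<Rightarrow> real. \<forall>\<^sub>F h in at_top.
       (\<Sum>A \<in> PiE {1..l} (\<lambda>i. subsets_of_size (B i h) (C i h) (k i)).
          singular_series (\<Union>i\<in>{1..l}. A i))
         = (\<Prod>i=1..l. (C i h - B i h) ^ k i / fact (k i)) * (1 + E h)
       \<and> \<bar>E h\<bar> \<le> (2 * C0 + 1) * (1 / ln (ln h))"
      by (rule exI[of _ "\<lambda>h. S h / M h - 1"], fold S_def M_def) (rule estimate)
  qed
qed

end
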